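(* In the setting of the spectral data described in the context, with $\hat{\mathcal D}\in T_0$, let $x=[y(z,\bar z,1)]:\mathbb C\to\mathbb{CP}^2$ be the totally real superconformal minimal immersion with $$y=\Big(\frac{\psi_1(P_1)}{\sqrt{W(P_1)}},\frac{\psi_1(P_2)}{\sqrt{W(P_2)}},\frac{\psi_1(P_3)}{\sqrt{W(P_3)}}\Big)^t ,$$ where $P_1,P_2,P_3$ are the three points of $\hat\Gamma$ over $\lambda=1$ (they lie on the fixed ovals of $\tau$). Then $x$ is doubly-periodic with respect to the lattice generated by $Z_1,Z_2\in\mathbb C$ (linearly independent over $\mathbb R$), i.e. $x(z+Z_k)=x(z)$ for $k=1,2$, if $$\mathrm{Re}(Z_kU)\in\pi\mathbb Z^g,\qquad \mathrm{Re}\Big(Z_k\int_{P_\infty}^P\Omega_\infty\Big)\in\pi\mathbb Z,\qquad k=1,2,$$ where $P$ is each of the points $P_1,P_2,P_3$ on the fixed ovals of $\hat\Gamma$.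
   Context: Curve. Let $g=d\equiv1\pmod6$ and let $\hat\Gamma$ be a compact Riemann surface of genus $\hat g=2g$ with two distinct points $P_0,P_\infty$, a meromorphic function $\lambda$ on $\hat\Gamma$ with divisor $3P_0-3P_\infty$, a holomorphic involution $\sigma$ with $\lambda(\sigma P)=-\lambda(P)$, and an antiholomorphic involution $\tau$ of separating type with $\lambda(\tau P)\overline{\lambda(P)}=1$. The fixed ovals of $\tau$ divide $\hat\Gamma$ into a region $\hat\Gamma_0\ni P_0$ and a region $\hat\Gamma_\infty\ni P_\infty$. All branch points of $\lambda$ other than $P_0,P_\infty$ have $|\lambda|\ne1$; their values come in pairs under $\lambda\mapsto-\lambda$ and $\lambda\mapsto1/\bar\lambda$. Homology and theta functions. $\{a_i,b_i\}_{i=1}^{\hat g}$ is a canonical basis of $H_1(\hat\Gamma,\mathbb Z)$ such that for $i=1,\dots,g$: $\sigma a_i=-a_{i+g}$, $\sigma b_i=-b_{i+g}$, $\tau a_i=-a_i$, $\tau b_i=b_i-a_i+\sum_{k=1}^ga_k$, $\tau a_{i+g}=-a_{i+g}$, $\tau b_{i+g}=b_{i+g}-a_{i+g}+\sum_{k=1}^ga_{k+g}$. Let $\omega_1,\dots,\omega_{\hat g}$ be the holomorphic differentials with $\oint_{a_i}\omega_j=2\pi i\,\delta_{ij}$. Put $\Pi_{kj}=\oint_{b_k}(\omega_j+\omega_{j+g})$, $k,j=1,\dots,g$, and define the Prym theta function $\eta(z)=\sum_{N\in\mathbb Z^g}\exp(\tfrac12\langle\Pi N,N\rangle+\langle z,N\rangle)$,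 $z\in\mathbb C^g$, and $\mathcal U_j(P)=\int_{P_\infty}^P(\omega_j+\omega_{j+g})$, $j=1,\dots,g$. Differentials. Local parameters are $\nu^{-1}$ at $P_\infty$ and $\varrho^{-1}$ at $P_0$ with $\nu^3=\lambda$, $\varrho(P)=\overline{\nu(\tau P)}$, both vanishing at the respective point and odd under $\sigma$. $\Omega_\infty,\Omega_0$ are Abelian differentials of the second kind with zero $a$-periods, with only pole at $P_\infty$, resp. $P_0$, where $\Omega_\infty=d\nu+\cdots$, resp. $\Omega_0=d\varrho+\cdots$; they satisfy $\sigma^*\Omega_\infty=-\Omega_\infty$, $\sigma^*\Omega_0=-\Omega_0$, $\tau^*\Omega_\infty=\overline{\Omega_0}$. Put $U_i=\oint_{b_i}\Omega_\infty$, $V_i=\oint_{b_i}\Omega_0$, $i=1,\dots,g$ (then $V=\bar U$). The constant $c$ is defined by the expansion $\Omega_0=c\,d(\nu^{-1})+\cdots$ at $P_\infty$. The integral $\int_{P_\infty}^P\Omega_\infty$ is regularized as $\nu+o(1)$ near $P_\infty$. Divisors. $\hat{\mathcal D}$ is an effective nonspecial divisor of degree $\hat g$ on $\hat\Gamma\setminus\{P_0,P_\infty\}$ such that $\hat{\mathcal D}+\sigma\hat{\mathcal D}$ is linearly equivalent to $P_0+P_\infty+\hat{\mathcal C}$ ($\hat{\mathcal C}$ the canonical class). The vector $e\in\mathbb C^g$ is chosen so that $\hat{\mathcal D}$ is the zero divisor of $P\mapsto\eta(\mathcal U(P)-e)$. We say $\hat{\mathcal D}\in T_0$ if in addition $\hat{\mathcal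 D}+\tau\hat{\mathcal D}$ is linearly equivalent to $P_0+P_\infty+\hat{\mathcal C}$ and the Abelian differential $\alpha$ of the third kind with zeros $\hat{\mathcal D}+\tau\hat{\mathcal D}$ and simple poles at $P_0,P_\infty$ with residues $+i,-i$ is positive on all fixed ovals of $\tau$, oriented as the boundary of $\hat\Gamma_\infty$. In that case $e^{\omega}=2\,\partial^2_{z\bar z}\ln\eta(iUz+iV\bar z-e)+c$ defines a real nonsingular solution of $\omega_{z\bar z}=e^{-2\omega}-e^\omega$ on $\mathbb C$ ($\bar z$ is the conjugate of $z$). Baker–Akhiezer function. $$\psi_1(P)=f(z,\bar z)\,\frac{\eta(\mathcal U(P)+iUz+iV\bar z-e)}{\eta(\mathcal U(P)-e)}\,\lambda^{-1}(P)\exp\Big(\int_{P_\infty}^P(iz\,\Omega_\infty+i\bar z\,\Omega_0)\Big),$$ with the same path in $\mathcal U(P)$ and in the exponent, and the factor $f$ independent of $P$ fixed by $\psi_1=\nu^{-3}e^{i\nu z}(1+o(1))$ at $P_\infty$. Finally $W(P)=i\,d\lambda(P)/(\lambda(P)\alpha(P))$, which is positive on the ovals of $\tau$. *)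

theory Defs
  imports "HOL-Complex_Analysis.Complex_Analysis" "HOL-Homology.Homology"
begin

section \<open>Riemann surfaces\<close>

type_synonym 'a chart = "'a set \<times> ('a \<Rightarrow> complex)"

record 'a surface =
  pts :: "'a topology"
  atlas :: "'a chart set"

definition chart_inv :: "'a chart \<Rightarrow> complex \<Rightarrow> 'a" where
  "chart_inv \<kappa> = inv_into (fst \<kappa>) (snd \<kappa>)"

definition riemann_surface :: "'a surface \<Rightarrow> bool" where
  "riemann_surface R \<longleftrightarrow>
     Hausdorff_space (pts R) \<and> connected_space (pts R) \<and>
     (\<Union>\<kappa>\<in>atlas R. fst \<kappa>) = topspace (pts R) \<and>
     (\<forall>\<kappa>\<in>atlas R. openin (pts R) (fst \<kappa>) \<and> open (snd \<kappa> ` fst \<kappa>) \<and>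
        homeomorphic_map (subtopology (pts R) (fst \<kappa>)) (top_of_set (snd \<kappa> ` fst \<kappa>)) (snd \<kappa>)) \<and>
     (\<forall>\<kappa>\<in>atlas R. \<forall>\<kappa>'\<in>atlas R.
        (snd \<kappa>' \<circ> chart_inv \<kappa>) holomorphic_on (snd \<kappa> ` (fst \<kappa> \<inter> fst \<kappa>')))"

definition compact_riemann_surface :: "'a surface \<Rightarrow> bool" where
  "compact_riemann_surface R \<longleftrightarrow>
     riemann_surface R \<and> compact_space (pts R) \<and> topspace (pts R) \<noteq> {}"

definition chart_at :: "'a surface \<Rightarrow> 'a \<Rightarrow> 'a chart" where
  "chart_at R p = (SOME \<kappa>. \<kappa> \<in> atlas R \<and> p \<in> fst \<kappa>)"

definition holomorphic_involution :: "'a surface \<Rightarrow> ('a \<Rightarrow> 'a) \<Rightarrow> bool" where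
  "holomorphic_involution R \<sigma> \<longleftrightarrow>
     continuous_map (pts R) (pts R) \<sigma> \<and> (\<forall>p\<in>topspace (pts R). \<sigma> (\<sigma> p) = p) \<and>
     (\<forall>\<kappa>\<in>atlas R. \<forall>\<kappa>'\<in>atlas R.
        (snd \<kappa>' \<circ> \<sigma> \<circ> chart_inv \<kappa>) holomorphic_on (snd \<kappa> ` {p \<in> fst \<kappa>. \<sigma> p \<in> fst \<kappa>'}))"

definition antiholomorphic_involution :: "'a surface \<Rightarrow> ('a \<Rightarrow> 'a) \<Rightarrow> bool" where
  "antiholomorphic_involution R \<tau> \<longleftrightarrow>
     continuous_map (pts R) (pts R) \<tau> \<and> (\<forall>p\<in>topspace (pts R). \<tau> (\<tau> p) = p) \<and>
     (\<forall>\<kappa>\<in>atlas R. \<forall>\<kappa>'\<in>atlas R.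
        (cnj \<circ> snd \<kappa>' \<circ> \<tau> \<circ> chart_inv \<kappa>) holomorphic_on (snd \<kappa> ` {p \<in> fst \<kappa>. \<tau> p \<in> fst \<kappa>'}))"

text \<open>The union of the fixed ovals of an antiholomorphic involution.\<close>

definition ovals :: "'a surface \<Rightarrow> ('a \<Rightarrow> 'a) \<Rightarrow> 'a set" where
  "ovals R \<tau> = {p \<in> topspace (pts R). \<tau> p = p}"

definition region :: "'a surface \<Rightarrow> ('a \<Rightarrow> 'a) \<Rightarrow> 'a \<Rightarrow> 'a set" where
  "region R \<tau> p =
     connected_component_of_set (subtopology (pts R) (topspace (pts R) - ovals R \<tau>)) p"

definition separating_type :: "'a surface \<Rightarrow> ('a \<Rightarrow> 'a) \<Rightarrow> bool" where
  "separating_type R \<tau> \<longleftrightarrow> \<not> connectedin (pts R) (topspace (pts R) - ovals R \<tau>)"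


section \<open>Meromorphic functions and differentials\<close>

text \<open>A differential is given by its coefficients: \<open>\<omega> \<kappa> p\<close> is the value at \<open>p\<close> of
  \<open>\<omega> / d(snd \<kappa>)\<close>. Only the values for charts \<open>\<kappa>\<close> of the atlas and \<open>p\<close> in the domain of
  \<open>\<kappa>\<close> are meaningful. Meromorphic functions and coefficients take the value 0 at their poles
  (this is the convention of \<open>nicely_meromorphic_on\<close>).\<close>

type_synonym 'a differential = "'a chart \<Rightarrow> 'a \<Rightarrow> complex"

definition meromorphic_fun :: "'a surface \<Rightarrow> ('a \<Rightarrow> complex) \<Rightarrow> bool" where
  "meromorphic_fun R F \<longleftrightarrow>
     (\<forall>\<kappa>\<in>atlas R. (F \<circ> chart_inv \<kappa>) nicely_meromorphic_on (snd \<kappa> ` fst \<kappa>))"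

definition differential_on :: "'a surface \<Rightarrow> 'a set \<Rightarrow> 'a differential \<Rightarrow> bool" where
  "differential_on R V \<omega> \<longleftrightarrow>
     (\<forall>\<kappa>\<in>atlas R. \<forall>\<kappa>'\<in>atlas R. \<forall>p \<in> V \<inter> fst \<kappa> \<inter> fst \<kappa>'.
        \<omega> \<kappa> p = \<omega> \<kappa>' p * deriv (snd \<kappa>' \<circ> chart_inv \<kappa>) (snd \<kappa> p))"

definition holomorphic_diff_on :: "'a surface \<Rightarrow> 'a set \<Rightarrow> 'a differential \<Rightarrow> bool" where
  "holomorphic_diff_on R V \<omega> \<longleftrightarrow> differential_on R V \<omega> \<and>
     (\<forall>\<kappa>\<in>atlas R. (\<omega> \<kappa> \<circ> chart_inv \<kappa>) holomorphic_on (snd \<kappa> ` (fst \<kappa> \<inter> V)))"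

definition meromorphic_diff :: "'a surface \<Rightarrow> 'a differential \<Rightarrow> bool" where
  "meromorphic_diff R \<omega> \<longleftrightarrow> differential_on R (topspace (pts R)) \<omega> \<and>
     (\<forall>\<kappa>\<in>atlas R. (\<omega> \<kappa> \<circ> chart_inv \<kappa>) nicely_meromorphic_on (snd \<kappa> ` fst \<kappa>))"

definition nonzero_diff :: "'a surface \<Rightarrow> 'a differential \<Rightarrow> bool" where
  "nonzero_diff R \<omega> \<longleftrightarrow> (\<exists>\<kappa>\<in>atlas R. \<exists>p\<in>fst \<kappa>. \<omega> \<kappa> p \<noteq> 0)"

definition diff_eq :: "'a surface \<Rightarrow> 'a differential \<Rightarrow> 'a differential \<Rightarrow> bool" where
  "diff_eq R \<omega> \<theta> \<longleftrightarrow> (\<forall>\<kappa>\<in>atlas R. \<forall>p\<in>fst \<kappa>. \<omega> \<kappa> p = \<theta> \<kappa> p)"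

definition d_fun :: "('a \<Rightarrow> complex) \<Rightarrow> 'a differential" where
  "d_fun F \<kappa> p = deriv (F \<circ> chart_inv \<kappa>) (snd \<kappa> p)"

text \<open>\<open>pullback\<close> is $\sigma^*\omega$ for holomorphic $\sigma$; \<open>conj_pullback\<close> is the differential
  $\overline{\tau^*\omega}$ for antiholomorphic $\tau$.\<close>

definition pullback :: "'a surface \<Rightarrow> ('a \<Rightarrow> 'a) \<Rightarrow> 'a differential \<Rightarrow> 'a differential" where
  "pullback R \<sigma> \<omega> \<kappa> p =
     (let \<kappa>' = chart_at R (\<sigma> p)
      in \<omega> \<kappa>' (\<sigma> p) * deriv (snd \<kappa>' \<circ> \<sigma> \<circ> chart_inv \<kappa>) (snd \<kappa> p))"

definition conj_pullback :: "'a surface \<Rightarrow> ('a \<Rightarrow> 'a) \<Rightarrow> 'a differential \<Rightarrow> 'a differential" where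
  "conj_pullback R \<tau> \<omega> \<kappa> p =
     (let \<kappa>' = chart_at R (\<tau> p)
      in cnj (\<omega> \<kappa>' (\<tau> p)) * deriv (cnj \<circ> snd \<kappa>' \<circ> \<tau> \<circ> chart_inv \<kappa>) (snd \<kappa> p))"

definition fun_order :: "'a surface \<Rightarrow> ('a \<Rightarrow> complex) \<Rightarrow> 'a \<Rightarrow> int" where
  "fun_order R F p = (let \<kappa> = chart_at R p in zorder (F \<circ> chart_inv \<kappa>) (snd \<kappa> p))"

definition diff_order :: "'a surface \<Rightarrow> 'a differential \<Rightarrow> 'a \<Rightarrow> int" where
  "diff_order R \<omega> p = (let \<kappa> = chart_at R p in zorder (\<omega> \<kappa> \<circ> chart_inv \<kappa>) (snd \<kappa> p))"

definition diff_residue :: "'a surface \<Rightarrow> 'a differential \<Rightarrow> 'a \<Rightarrow> complex" where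
  "diff_residue R \<omega> p = (let \<kappa> = chart_at R p in residue (\<omega> \<kappa> \<circ> chart_inv \<kappa>) (snd \<kappa> p))"

definition local_parameter :: "'a surface \<Rightarrow> ('a \<Rightarrow> complex) \<Rightarrow> 'a \<Rightarrow> bool" where
  "local_parameter R k p \<longleftrightarrow> k p = 0 \<and>
     (\<exists>V. openin (pts R) V \<and> p \<in> V \<and>
        (\<forall>\<kappa>\<in>atlas R. (k \<circ> chart_inv \<kappa>) holomorphic_on (snd \<kappa> ` (fst \<kappa> \<inter> V))) \<and>
        (\<forall>\<kappa>\<in>atlas R. p \<in> fst \<kappa> \<longrightarrow> deriv (k \<circ> chart_inv \<kappa>) (snd \<kappa> p) \<noteq> 0))"

text \<open>Differential of the second kind with only pole at \<open>p\<close>, where \<open>\<Omega> = du + holomorphic\<close>.\<close>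

definition second_kind :: "'a surface \<Rightarrow> 'a differential \<Rightarrow> ('a \<Rightarrow> complex) \<Rightarrow> 'a \<Rightarrow> bool" where
  "second_kind R \<Omega> u p \<longleftrightarrow>
     meromorphic_diff R \<Omega> \<and> holomorphic_diff_on R (topspace (pts R) - {p}) \<Omega> \<and>
     (\<exists>V \<theta>. openin (pts R) V \<and> p \<in> V \<and> holomorphic_diff_on R V \<theta> \<and>
        (\<forall>\<kappa>\<in>atlas R. \<forall>q \<in> V \<inter> fst \<kappa> - {p}. \<Omega> \<kappa> q = d_fun u \<kappa> q + \<theta> \<kappa> q))"


section \<open>Divisors\<close>

text \<open>A divisor is an integer-valued function; only its values on the surface matter.\<close>

definition pt :: "'a \<Rightarrow> 'a \<Rightarrow> int" where
  "pt p = (\<lambda>q. if q = p then 1 else 0)"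

definition lin_equiv :: "'a surface \<Rightarrow> ('a \<Rightarrow> int) \<Rightarrow> ('a \<Rightarrow> int) \<Rightarrow> bool" where
  "lin_equiv R D E \<longleftrightarrow>
     (\<exists>F. meromorphic_fun R F \<and> (\<exists>p\<in>topspace (pts R). F p \<noteq> 0) \<and>
          (\<forall>p\<in>topspace (pts R). D p - E p = fun_order R F p))"

definition canonical_divisor :: "'a surface \<Rightarrow> ('a \<Rightarrow> int) \<Rightarrow> bool" where
  "canonical_divisor R K \<longleftrightarrow>
     (\<exists>\<theta>. meromorphic_diff R \<theta> \<and> nonzero_diff R \<theta> \<and>
          (\<forall>p\<in>topspace (pts R). K p = diff_order R \<theta> p))"

text \<open>Nonspecial means index of speciality zero.\<close>

definition nonspecial :: "'a surface \<Rightarrow> ('a \<Rightarrow> nat) \<Rightarrow> bool" where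
  "nonspecial R D \<longleftrightarrow>
     \<not> (\<exists>\<theta>. holomorphic_diff_on R (topspace (pts R)) \<theta> \<and> nonzero_diff R \<theta> \<and>
            (\<forall>p\<in>topspace (pts R). int (D p) \<le> diff_order R \<theta> p))"

text \<open>\<open>v\<close>, read in the chart \<open>\<kappa>\<close> at \<open>p\<close>, is a positively oriented tangent vector of the curve
  \<open>C\<close> regarded as boundary of \<open>G\<close>: the region \<open>G\<close> lies to the left of \<open>v\<close>.\<close>

definition boundary_tangent :: "'a set \<Rightarrow> 'a set \<Rightarrow> 'a chart \<Rightarrow> 'a \<Rightarrow> complex \<Rightarrow> bool" where
  "boundary_tangent C G \<kappa> p v \<longleftrightarrow> v \<noteq> 0 \<and>
     (\<exists>c :: real \<Rightarrow> 'a. c 0 = p \<and> (\<forall>\<^sub>F t in nhds 0. c t \<in> C \<inter> fst \<kappa>) \<and>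
        ((\<lambda>t. snd \<kappa> (c t)) has_vector_derivative v) (at 0)) \<and>
     (\<forall>\<^sub>F t in at_right 0. snd \<kappa> p + complex_of_real t * (\<i> * v) \<in> snd \<kappa> ` (G \<inter> fst \<kappa>))"

definition positive_on_boundary :: "'a surface \<Rightarrow> 'a set \<Rightarrow> 'a set \<Rightarrow> 'a differential \<Rightarrow> bool" where
  "positive_on_boundary R C G \<alpha> \<longleftrightarrow>
     (\<forall>\<kappa>\<in>atlas R. \<forall>p \<in> C \<inter> fst \<kappa>. \<forall>v. boundary_tangent C G \<kappa> p v \<longrightarrow>
        (\<exists>r>0. \<alpha> \<kappa> p * v = complex_of_real r))"


section \<open>Integration along paths\<close>

text \<open>Paths are continuous maps on \<open>{0..1}\<close>; the integral of a meromorphic differential along a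
  path is computed with local primitives. A differential has no primitive near a pole in
  the sense of \<open>primitive_on\<close>, so the paths have to avoid the poles.\<close>

definition primitive_on :: "'a surface \<Rightarrow> 'a set \<Rightarrow> ('a \<Rightarrow> complex) \<Rightarrow> 'a differential \<Rightarrow> bool" where
  "primitive_on R V G \<omega> \<longleftrightarrow> openin (pts R) V \<and>
     (\<forall>\<kappa>\<in>atlas R. \<forall>p \<in> V \<inter> fst \<kappa>.
        ((G \<circ> chart_inv \<kappa>) has_field_derivative \<omega> \<kappa> p) (at (snd \<kappa> p)))"

definition primitive_along ::
    "'a surface \<Rightarrow> real set \<Rightarrow> 'a differential \<Rightarrow> (real \<Rightarrow> 'a) \<Rightarrow> (real \<Rightarrow> complex) \<Rightarrow> bool" where
  "primitive_along R T \<omega> \<gamma> F \<longleftrightarrow>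
     (\<forall>t\<in>T. \<exists>V G d. primitive_on R V G \<omega> \<and> 0 < d \<and>
        (\<forall>s\<in>T. \<bar>s - t\<bar> < d \<longrightarrow> \<gamma> s \<in> V \<and> F s = G (\<gamma> s)))"

definition path_integral :: "'a surface \<Rightarrow> 'a differential \<Rightarrow> (real \<Rightarrow> 'a) \<Rightarrow> complex" where
  "path_integral R \<omega> \<gamma> = (THE I. \<exists>F. primitive_along R {0..1} \<omega> \<gamma> F \<and> I = F 1 - F 0)"

text \<open>Integral along a path that starts at a pole, regularized as \<open>u + o(1)\<close> near the pole.\<close>

definition reg_path_integral ::
    "'a surface \<Rightarrow> ('a \<Rightarrow> complex) \<Rightarrow> 'a differential \<Rightarrow> (real \<Rightarrow> 'a) \<Rightarrow> complex" where
  "reg_path_integral R u \<omega> \<gamma> =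
     (THE I. \<exists>F. primitive_along R {0<..1} \<omega> \<gamma> F \<and>
        ((\<lambda>t. F t - u (\<gamma> t)) \<longlongrightarrow> 0) (at_right 0) \<and> I = F 1)"


section \<open>Homology\<close>

definition loop :: "'a surface \<Rightarrow> (real \<Rightarrow> 'a) \<Rightarrow> bool" where
  "loop R \<gamma> \<longleftrightarrow> pathin (pts R) \<gamma> \<and> \<gamma> 0 = \<gamma> 1"

text \<open>The singular 1-simplex of a path; the barycentric coordinate \<open>x 1\<close> is the path parameter.\<close>

definition path_chain :: "(real \<Rightarrow> 'a) \<Rightarrow> 'a chain" where
  "path_chain \<gamma> = frag_of (restrict (\<lambda>x. \<gamma> (x 1)) (standard_simplex 1))"

abbreviation homologous :: "'a surface \<Rightarrow> 'a chain \<Rightarrow> 'a chain \<Rightarrow> bool" where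
  "homologous R \<equiv> homologous_rel 1 (pts R) {}"

definition has_genus :: "'a surface \<Rightarrow> nat \<Rightarrow> bool" where
  "has_genus R h \<longleftrightarrow> homology_group 1 (pts R) \<cong> free_Abelian_group {..<2 * h}"

definition crossings :: "(real \<Rightarrow> 'a) \<Rightarrow> (real \<Rightarrow> 'a) \<Rightarrow> (real \<times> real) set" where
  "crossings \<gamma> \<delta> = {(s, t). s \<in> {0..1} \<and> t \<in> {0..1} \<and> \<gamma> s = \<delta> t}"

definition velocity :: "'a surface \<Rightarrow> (real \<Rightarrow> 'a) \<Rightarrow> real \<Rightarrow> complex" where
  "velocity R \<gamma> s = vector_derivative (snd (chart_at R (\<gamma> s)) \<circ> \<gamma>) (at s)"

definition velocity_exists :: "'a surface \<Rightarrow> (real \<Rightarrow> 'a) \<Rightarrow> real \<Rightarrow> bool" where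
  "velocity_exists R \<gamma> s \<longleftrightarrow> (snd (chart_at R (\<gamma> s)) \<circ> \<gamma>) differentiable (at s)"

text \<open>For \<open>\<gamma> s = \<delta> t\<close> this is positive iff the two velocities form a positively oriented basis.\<close>

definition crossing_det ::
    "'a surface \<Rightarrow> (real \<Rightarrow> 'a) \<Rightarrow> (real \<Rightarrow> 'a) \<Rightarrow> real \<times> real \<Rightarrow> real" where
  "crossing_det R \<gamma> \<delta> x = Im (cnj (velocity R \<gamma> (fst x)) * velocity R \<delta> (snd x))"

definition transversal :: "'a surface \<Rightarrow> (real \<Rightarrow> 'a) \<Rightarrow> (real \<Rightarrow> 'a) \<Rightarrow> bool" where
  "transversal R \<gamma> \<delta> \<longleftrightarrow> finite (crossings \<gamma> \<delta>) \<and> crossings \<gamma> \<delta> \<subseteq> {0<..<1} \<times> {0<..<1} \<and>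
     (\<forall>(s, t)\<in>crossings \<gamma> \<delta>. velocity_exists R \<gamma> s \<and> velocity_exists R \<delta> t \<and>
        crossing_det R \<gamma> \<delta> (s, t) \<noteq> 0)"

text \<open>The intersection number of two homology classes: signed count of the crossings of
  transversal representatives.\<close>

definition intersection_number :: "'a surface \<Rightarrow> 'a chain \<Rightarrow> 'a chain \<Rightarrow> int \<Rightarrow> bool" where
  "intersection_number R c d n \<longleftrightarrow>
     (\<exists>\<gamma> \<delta>. loop R \<gamma> \<and> loop R \<delta> \<and> homologous R c (path_chain \<gamma>) \<and>
        homologous R d (path_chain \<delta>) \<and> transversal R \<gamma> \<delta> \<and>
        (\<Sum>x\<in>crossings \<gamma> \<delta>. sgn (crossing_det R \<gamma> \<delta> x)) = real_of_int n)"

definition homology_basis ::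
    "'a surface \<Rightarrow> nat \<Rightarrow> (nat \<Rightarrow> 'a chain) \<Rightarrow> (nat \<Rightarrow> 'a chain) \<Rightarrow> bool" where
  "homology_basis R h A B \<longleftrightarrow>
     (\<forall>c. singular_relcycle 1 (pts R) {} c \<longrightarrow>
        (\<exists>m n. homologous R c (\<Sum>i=1..h. frag_cmul (m i) (A i) + frag_cmul (n i) (B i)))) \<and>
     (\<forall>m n. homologous R (\<Sum>i=1..h. frag_cmul (m i) (A i) + frag_cmul (n i) (B i)) 0 \<longrightarrow>
        (\<forall>i\<in>{1..h}. m i = 0 \<and> n i = 0))"

definition canonical_basis ::
    "'a surface \<Rightarrow> nat \<Rightarrow> (nat \<Rightarrow> real \<Rightarrow> 'a) \<Rightarrow> (nat \<Rightarrow> real \<Rightarrow> 'a) \<Rightarrow> bool" where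
  "canonical_basis R h a b \<longleftrightarrow>
     (\<forall>i\<in>{1..h}. loop R (a i) \<and> loop R (b i)) \<and>
     homology_basis R h (\<lambda>i. path_chain (a i)) (\<lambda>i. path_chain (b i)) \<and>
     (\<forall>i\<in>{1..h}. \<forall>j\<in>{1..h}.
        intersection_number R (path_chain (a i)) (path_chain (a j)) 0 \<and>
        intersection_number R (path_chain (b i)) (path_chain (b j)) 0 \<and>
        intersection_number R (path_chain (a i)) (path_chain (b j)) (if i = j then 1 else 0))"


section \<open>Prym theta function and Abel--Prym map\<close>

text \<open>Vectors in $\mathbb C^g$ are functions on \<open>nat\<close> evaluated at the indices \<open>1..g\<close>.\<close>

definition prym_theta :: "nat \<Rightarrow> (nat \<Rightarrow> nat \<Rightarrow> complex) \<Rightarrow> (nat \<Rightarrow> complex) \<Rightarrow> complex" where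
  "prym_theta g Per z =
     infsum (\<lambda>N. exp ((\<Sum>k=1..g. \<Sum>j=1..g. Per k j * of_int (N j) * of_int (N k)) / 2
                      + (\<Sum>k=1..g. z k * of_int (N k))))
       ({1..g} \<rightarrow>\<^sub>E (UNIV :: int set))"

definition prym_diff :: "nat \<Rightarrow> (nat \<Rightarrow> 'a differential) \<Rightarrow> nat \<Rightarrow> 'a differential" where
  "prym_diff g \<omega> j = (\<lambda>\<kappa> p. \<omega> j \<kappa> p + \<omega> (j + g) \<kappa> p)"

definition prym_map ::
    "'a surface \<Rightarrow> nat \<Rightarrow> (nat \<Rightarrow> 'a differential) \<Rightarrow> (real \<Rightarrow> 'a) \<Rightarrow> nat \<Rightarrow> complex" where
  "prym_map R g \<omega> \<gamma> j = path_integral R (prym_diff g \<omega> j) \<gamma>"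

text \<open>\<open>D\<close> is the zero divisor of the multivalued function $P\mapsto\eta(\mathcal U(P)-e)$: every branch
  of it near \<open>p\<close>, i.e. every choice of the path \<open>\<gamma>\<close> from the base point \<open>q\<close> to \<open>p\<close>, has order
  \<open>D p\<close> at \<open>p\<close>.\<close>

definition prym_theta_zero_divisor ::
    "'a surface \<Rightarrow> nat \<Rightarrow> (nat \<Rightarrow> 'a differential) \<Rightarrow> 'a \<Rightarrow> (nat \<Rightarrow> nat \<Rightarrow> complex) \<Rightarrow>
     (nat \<Rightarrow> complex) \<Rightarrow> ('a \<Rightarrow> nat) \<Rightarrow> bool" where
  "prym_theta_zero_divisor R g \<omega> q Per e D \<longleftrightarrow>
     (\<forall>p\<in>topspace (pts R). \<forall>\<gamma> V G.
        pathin (pts R) \<gamma> \<and> \<gamma> 0 = q \<and> \<gamma> 1 = p \<and> p \<in> V \<and>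
        (\<forall>j\<in>{1..g}. primitive_on R V (G j) (prym_diff g \<omega> j) \<and> G j p = prym_map R g \<omega> \<gamma> j) \<longrightarrow>
        (let \<kappa> = chart_at R p; h = (\<lambda>w. prym_theta g Per (\<lambda>j. G j (chart_inv \<kappa> w) - e j))
         in (\<forall>\<^sub>F w in at (snd \<kappa> p). h w \<noteq> 0) \<and> zorder h (snd \<kappa> p) = int (D p)))"


section \<open>The complex projective plane\<close>

typedef cp2 = "{L :: (complex ^ 3) set. \<exists>v. v \<noteq> 0 \<and> L = range (\<lambda>c. c *s v)}"
proof -
  have "(1 :: complex ^ 3) \<noteq> 0"
    by (metis one_index zero_index zero_neq_one)
  then show ?thesis
    by blast
qed

definition proj_point :: "complex ^ 3 \<Rightarrow> cp2" where
  "proj_point v = Abs_cp2 (range (\<lambda>c. c *s v))"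

end

theory Submission
  imports Defs
begin

text \<open>The three homogeneous coordinates are \<open>\<psi> z (P j)\<close> up to constants \<open>1 / csqrt (W (P j))\<close>, so it
suffices that a shift of \<open>z\<close> by a period \<open>Z\<close> multiplies all \<open>\<psi> z (P j)\<close> by one common nonzero
factor.

The argument of the theta function changes by \<open>\<i> * (Z * U i) + \<i> * (cnj Z * V i)\<close>. Once
\<open>V = cnj U\<close> is known, this is \<open>2 * \<i> * Re (Z * U i)\<close>, a multiple of \<open>2 * pi * \<i>\<close>, and the theta
function is periodic (\<open>prym_theta_periodic\<close>).

The exponent changes by \<open>\<i> * Z * A j + \<i> * cnj Z * B j\<close>, where \<open>A j\<close> is the regularized integral
of \<open>\<Omega>inf\<close> and \<open>B j\<close> the integral of \<open>\<Omega>0\<close> along the path to \<open>P j\<close>. Here the crux is that \<open>B j\<close>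
equals \<open>cnj (A j)\<close> up to a constant that does not depend on \<open>j\<close>, although the paths are
arbitrary; then the change is \<open>2 * \<i> * Re (Z * A j)\<close> plus a common constant, and the first
summand is a multiple of \<open>2 * pi * \<i>\<close>. Since \<open>\<Omega>0\<close> is the conjugate of the pullback of \<open>\<Omega>inf\<close>
under \<open>\<tau>\<close>, \<open>B j\<close> is the conjugate of the integral of \<open>\<Omega>inf\<close> along the mirror image of the path
(\<open>conj_pullback_path_integral\<close>). For two of the points, the paths and their mirror images form a
cycle \<open>c\<close> with \<open>\<tau> c = - c\<close>. By the action of \<open>\<tau>\<close> on the canonical basis such a cycle is
homologous to a combination of \<open>a\<close>-cycles (\<open>anti_invariant_cycle\<close>), over which \<open>\<Omega>inf\<close> is
normalized to have no periods (\<open>antisymmetric_increment\<close>). The relation \<open>V = cnj U\<close> follows in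
the same way from the action of \<open>\<tau>\<close> on the \<open>b\<close>-cycles.

This uses that integrals of \<open>\<Omega>inf\<close> over cycles depend only on the homology class in the compact
surface, even though the bounding singular simplices, and the paths themselves, may pass through
the pole. To see this, \<open>\<Omega>inf\<close> is replaced by a family of local functions without singularity:
near the pole, the primitives of \<open>\<Omega>inf - d\<nu>\<close>; elsewhere, the primitives of \<open>\<Omega>inf\<close> minus a
cut-off of \<open>\<nu>\<close>. Functions of such a family differ by local constants, so they can be continued
along paths, and the resulting increments add up to zero around every singular triangle
(\<open>increment_triangle\<close>, \<open>chain_increment_homologous\<close>). Integrals of \<open>\<Omega>inf\<close>, regularized or not,
are increments up to values of the cut-off at the endpoints (locale \<open>pole_datum\<close>).\<close>

section \<open>Continuation of locally defined functions along paths\<close>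

text \<open>A path is continued through a family \<open>\<G>\<close> of pairs of an open set and a function on it, as in analytic
continuation. For the primitives of a differential this is \<open>primitive_along\<close>; a general
family is allowed so that the same theory also covers a differential with its polar part removed.\<close>

definition continuation ::
    "('a set \<Rightarrow> ('a \<Rightarrow> complex) \<Rightarrow> bool) \<Rightarrow> real set \<Rightarrow> (real \<Rightarrow> 'a) \<Rightarrow> (real \<Rightarrow> complex) \<Rightarrow> bool" where
  "continuation \<G> T \<gamma> F \<longleftrightarrow>
     (\<forall>t\<in>T. \<exists>V G d. \<G> V G \<and> 0 < d \<and> (\<forall>s\<in>T. \<bar>s - t\<bar> < d \<longrightarrow> \<gamma> s \<in> V \<and> F s = G (\<gamma> s)))"

lemma continuation_subset:
  "continuation \<G> T \<gamma> F \<Longrightarrow> S \<subseteq> T \<Longrightarrow> continuation \<G> S \<gamma> F"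
  unfolding continuation_def by (meson subsetD)

lemma continuation_cong:
  assumes "continuation \<G> T \<gamma> F" "\<And>t. t \<in> T \<Longrightarrow> \<gamma>' t = \<gamma> t" "\<And>t. t \<in> T \<Longrightarrow> F' t = F t"
  shows "continuation \<G> T \<gamma>' F'"
  using assms unfolding continuation_def by metis

lemma continuation_compose:
  assumes F: "continuation \<G> T \<gamma> F" and \<phi>: "continuous_on S \<phi>" "\<phi> ` S \<subseteq> T"
  shows "continuation \<G> S (\<gamma> \<circ> \<phi>) (F \<circ> \<phi>)"
  unfolding continuation_def
proof
  fix t assume t: "t \<in> S"
  then have "\<phi> t \<in> T" using \<phi> by auto
  then obtain V G d where V: "\<G> V G" "0 < d"
    and d: "\<And>s. s \<in> T \<Longrightarrow> \<bar>s - \<phi> t\<bar> < d \<Longrightarrow> \<gamma> s \<in> V \<and> F s = G (\<gamma> s)"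
    using F unfolding continuation_def by metis
  obtain d' where "0 < d'" and d': "\<And>s. s \<in> S \<Longrightarrow> dist s t < d' \<Longrightarrow> dist (\<phi> s) (\<phi> t) < d"
    using \<phi>(1) t \<open>0 < d\<close> unfolding continuous_on_iff by metis
  have "\<forall>s\<in>S. \<bar>s - t\<bar> < d' \<longrightarrow> (\<gamma> \<circ> \<phi>) s \<in> V \<and> (F \<circ> \<phi>) s = G ((\<gamma> \<circ> \<phi>) s)"
    using d d' \<phi>(2) by (auto simp: dist_real_def image_subset_iff)
  with V \<open>0 < d'\<close> show "\<exists>V G d. \<G> V G \<and> 0 < d \<and> 
      (\<forall>s\<in>S. \<bar>s - t\<bar> < d \<longrightarrow> (\<gamma> \<circ> \<phi>) s \<in> V \<and> (F \<circ> \<phi>) s = G ((\<gamma> \<circ> \<phi>) s))"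
    by blast
qed

lemma continuous_map_near_real:
  assumes "continuous_map (top_of_set T) X \<gamma>" "openin X W" "t \<in> T" "\<gamma> t \<in> W"
  obtains d where "0 < d" "\<And>s. s \<in> T \<Longrightarrow> dist s t < d \<Longrightarrow> \<gamma> s \<in> W"
proof -
  have "openin (top_of_set T) {s \<in> topspace (top_of_set T). \<gamma> s \<in> W}"
    using assms(1,2) by (rule openin_continuous_map_preimage)
  then have "\<exists>d>0. \<forall>s\<in>T. dist s t < d \<longrightarrow> \<gamma> s \<in> W"
    using assms(3,4) by (auto simp: openin_euclidean_subtopology_iff)
  then show ?thesis using that by blast
qed

lemma dist_midpoints:
  fixes a b c :: "'b::euclidean_space"
  shows "dist (midpoint a b) (midpoint a c) = dist b c / 2"
proof -
  have "midpoint a b - midpoint a c = (1 / 2) *\<^sub>R (b - c)"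
    by (rule euclidean_eqI) (simp add: midpoint_def inner_simps field_simps)
  then show ?thesis by (simp add: dist_norm)
qed

text \<open>The functions of \<open>\<G>\<close> form a flat family: on overlaps they differ by locally constant functions, so
a continuation along a path is determined up to a constant. The individual functions may be
discontinuous, which leaves room for subtracting a cut-off function.\<close>

locale local_system =
  fixes X :: "'a topology" and \<G> :: "'a set \<Rightarrow> ('a \<Rightarrow> complex) \<Rightarrow> bool"
  assumes open_dom: "\<G> V G \<Longrightarrow> openin X V"
    and add_const: "\<G> V G \<Longrightarrow> \<G> V (\<lambda>p. G p + c)"
    and agree: "\<G> V G \<Longrightarrow> \<G> V' G' \<Longrightarrow> p \<in> V \<Longrightarrow> p \<in> V' \<Longrightarrow>
      \<exists>W. openin X W \<and> p \<in> W \<and> (\<forall>q\<in>W. G q - G' q = G p - G' p)"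
begin

text \<open>The difference of two continuations is locally constant along the path, hence constant on a
connected parameter set.\<close>

lemma continuation_unique:
  assumes T: "connected T" and \<gamma>: "continuous_map (top_of_set T) X \<gamma>"
    and F: "continuation \<G> T \<gamma> F" and F': "continuation \<G> T \<gamma> F'" and st: "s \<in> T" "t \<in> T"
  shows "F s - F' s = F t - F' t"
proof (rule connected_local_const[OF T st, where f = "\<lambda>t. F t - F' t"], rule ballI)
  fix t assume t: "t \<in> T"
  obtain V G d where V: "\<G> V G" "0 < d"
    and d: "\<And>s. s \<in> T \<Longrightarrow> \<bar>s - t\<bar> < d \<Longrightarrow> \<gamma> s \<in> V \<and> F s = G (\<gamma> s)"
    using F t unfolding continuation_def by metis
  obtain V' G' d' where V': "\<G> V' G'" "0 < d'"
    and d': "\<And>s. s \<in> T \<Longrightarrow> \<bar>s - t\<bar> < d' \<Longrightarrow> \<gamma> s \<in> V' \<and> F' s = G' (\<gamma> s)"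
    using F' t unfolding continuation_def by metis
  have "\<gamma> t \<in> V" "\<gamma> t \<in> V'" using d[OF t] d'[OF t] V V' by auto
  then obtain W where W: "openin X W" "\<gamma> t \<in> W" "\<forall>q\<in>W. G q - G' q = G (\<gamma> t) - G' (\<gamma> t)"
    using agree[OF V(1) V'(1)] by blast
  obtain e where e: "0 < e" "\<And>s. s \<in> T \<Longrightarrow> dist s t < e \<Longrightarrow> \<gamma> s \<in> W"
    using continuous_map_near_real[OF \<gamma> W(1) t W(2)] by metis
  have "F t - F' t = F s - F' s" if "s \<in> T" "dist s t < min e (min d d')" for s
    using that d[of s] d'[of s] d[OF t] d'[OF t] V(2) V'(2) e(2)[of s] W(3) by (auto simp: dist_real_def)
  moreover have "0 < min e (min d d')" using V V' e by auto
  ultimately show "\<forall>\<^sub>F s in at t within T. F t - F' t = F s - F' s"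
    unfolding eventually_at by blast
qed

lemma continuation_add_const:
  assumes "continuation \<G> T \<gamma> F"
  shows "continuation \<G> T \<gamma> (\<lambda>t. F t + c)"
  unfolding continuation_def
proof
  fix t assume "t \<in> T"
  then obtain V G d where V: "\<G> V G" "0 < d"
    and d: "\<forall>s\<in>T. \<bar>s - t\<bar> < d \<longrightarrow> \<gamma> s \<in> V \<and> F s = G (\<gamma> s)"
    using assms(1) unfolding continuation_def by metis
  have "\<forall>s\<in>T. \<bar>s - t\<bar> < d \<longrightarrow> \<gamma> s \<in> V \<and> F s + c = (\<lambda>p. G p + c) (\<gamma> s)" using d by simp
  with V(2) add_const[OF V(1)] show "\<exists>V G d. \<G> V G \<and> 0 < d \<and>
      (\<forall>s\<in>T. \<bar>s - t\<bar> < d \<longrightarrow> \<gamma> s \<in> V \<and> F s + c = G (\<gamma> s))" by blast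
qed

text \<open>By bisection: near each parameter one function of \<open>\<G>\<close> serves, and two continuations on adjacent
intervals fit together after adding a constant to the second.\<close>

lemma continuation_exists:
  assumes \<gamma>: "pathin X \<gamma>" and cover: "\<And>p. p \<in> topspace X \<Longrightarrow> \<exists>V G. \<G> V G \<and> p \<in> V"
  shows "\<exists>F. continuation \<G> {0..1} \<gamma> F"
proof -
  have c: "continuous_map (top_of_set {0..1}) X \<gamma>" using \<gamma> by (simp add: pathin_def)
  have "0 \<le> (0::real) \<and> (1::real) \<le> 1 \<longrightarrow> (\<exists>F. continuation \<G> {0..1} \<gamma> F)"
  proof (rule Bolzano[of 0 1 "\<lambda>a b. 0 \<le> a \<and> b \<le> 1 \<longrightarrow> (\<exists>F. continuation \<G> {a..b} \<gamma> F)"])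
    fix a b c :: real
    assume ab: "0 \<le> a \<and> b \<le> 1 \<longrightarrow> (\<exists>F. continuation \<G> {a..b} \<gamma> F)"
      and bc: "0 \<le> b \<and> c \<le> 1 \<longrightarrow> (\<exists>F. continuation \<G> {b..c} \<gamma> F)" and le: "a \<le> b" "b \<le> c"
    show "0 \<le> a \<and> c \<le> 1 \<longrightarrow> (\<exists>F. continuation \<G> {a..c} \<gamma> F)"
    proof
      assume ac: "0 \<le> a \<and> c \<le> 1"
      obtain F1 where F1: "continuation \<G> {a..b} \<gamma> F1" using ab ac le by auto
      obtain F2 where F2: "continuation \<G> {b..c} \<gamma> F2" using bc ac le by auto
      define F where "F t = (if t \<le> b then F1 t else F2 t + (F1 b - F2 b))" for t
      have "continuation \<G> {a..c} \<gamma> F"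
        unfolding continuation_def
      proof
        fix t assume t: "t \<in> {a..c}"
        consider "t < b" | "t > b" | "t = b" by linarith
        then show "\<exists>V G d. \<G> V G \<and> 0 < d \<and> (\<forall>s\<in>{a..c}. \<bar>s - t\<bar> < d \<longrightarrow> \<gamma> s \<in> V \<and> F s = G (\<gamma> s))"
        proof cases
          case 1
          obtain V G d where V: "\<G> V G" "0 < d"
            and d: "\<forall>s\<in>{a..b}. \<bar>s - t\<bar> < d \<longrightarrow> \<gamma> s \<in> V \<and> F1 s = G (\<gamma> s)"
            using F1 t 1 unfolding continuation_def by (metis atLeastAtMost_iff less_imp_le)
          have "\<forall>s\<in>{a..c}. \<bar>s - t\<bar> < min d (b - t) \<longrightarrow> \<gamma> s \<in> V \<and> F s = G (\<gamma> s)"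
            using d by (auto simp: F_def)
          moreover have "0 < min d (b - t)" using V 1 by simp
          ultimately show ?thesis using V by blast
        next
          case 2
          obtain V G d where V: "\<G> V G" "0 < d"
            and d: "\<forall>s\<in>{b..c}. \<bar>s - t\<bar> < d \<longrightarrow> \<gamma> s \<in> V \<and> F2 s = G (\<gamma> s)"
            using F2 t 2 unfolding continuation_def by (metis atLeastAtMost_iff less_imp_le)
          have "\<forall>s\<in>{a..c}. \<bar>s - t\<bar> < min d (t - b) \<longrightarrow> \<gamma> s \<in> V \<and> F s = G (\<gamma> s) + (F1 b - F2 b)"
            using d by (auto simp: F_def)
          moreover have "0 < min d (t - b)" using V 2 by simp
          ultimately show ?thesis using add_const[OF V(1), of "F1 b - F2 b"] by blast
        next
          \<comment> \<open>At the common endpoint the two local functions agree after the shift, on a neighbourhood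
            \<open>W\<close>; the first one therefore serves on both sides.\<close>
          case 3
          obtain V1 G1 d1 where V1: "\<G> V1 G1" "0 < d1"
            and d1: "\<forall>s\<in>{a..b}. \<bar>s - b\<bar> < d1 \<longrightarrow> \<gamma> s \<in> V1 \<and> F1 s = G1 (\<gamma> s)"
            using F1 le unfolding continuation_def by (metis atLeastAtMost_iff order_refl)
          obtain V2 G2 d2 where V2: "\<G> V2 G2" "0 < d2"
            and d2: "\<forall>s\<in>{b..c}. \<bar>s - b\<bar> < d2 \<longrightarrow> \<gamma> s \<in> V2 \<and> F2 s = G2 (\<gamma> s)"
            using F2 le unfolding continuation_def by (metis atLeastAtMost_iff order_refl)
          have b: "\<gamma> b \<in> V1" "\<gamma> b \<in> V2" "F1 b = G1 (\<gamma> b)" "F2 b = G2 (\<gamma> b)"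
            using d1 d2 V1 V2 le by auto
          obtain W where W: "openin X W" "\<gamma> b \<in> W" "\<forall>q\<in>W. G1 q - G2 q = G1 (\<gamma> b) - G2 (\<gamma> b)"
            using agree[OF V1(1) V2(1) b(1,2)] by blast
          have b01: "b \<in> {0..1}" using ac le by auto
          obtain e where e: "0 < e" "\<And>s. s \<in> {0..1} \<Longrightarrow> dist s b < e \<Longrightarrow> \<gamma> s \<in> W \<inter> V1"
            using continuous_map_near_real[OF c openin_Int[OF W(1) open_dom[OF V1(1)]] b01] W(2) b(1)
            by (metis IntI)
          have "\<gamma> s \<in> V1 \<and> F s = G1 (\<gamma> s)"
            if s: "s \<in> {a..c}" "\<bar>s - b\<bar> < min e (min d1 d2)" for s
          proof -
            have s': "\<gamma> s \<in> W" "\<gamma> s \<in> V1" using e(2)[of s] s ac by (auto simp: dist_real_def)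
            show ?thesis
            proof (cases "s \<le> b")
              case True
              then show ?thesis using d1 s s' by (simp add: F_def)
            next
              case False
              then have "F2 s = G2 (\<gamma> s)" using d2 s by auto
              moreover have "G1 (\<gamma> s) - G2 (\<gamma> s) = G1 (\<gamma> b) - G2 (\<gamma> b)" using W(3) s'(1) by blast
              ultimately show ?thesis using False s' b by (simp add: F_def algebra_simps)
            qed
          qed
          moreover have "0 < min e (min d1 d2)" using e V1 V2 by simp
          ultimately show ?thesis using V1 3 by blast
        qed
      qed
      then show "\<exists>F. continuation \<G> {a..c} \<gamma> F" by blast
    qed
  next
    fix t :: real
    assume "0 \<le> t" "t \<le> 1"
    then have t: "t \<in> {0..1}" by simp
    then have "\<gamma> t \<in> topspace X" using c by (auto simp: continuous_map_def)
    then obtain V G where V: "\<G> V G" "\<gamma> t \<in> V" using cover by blast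
    obtain d where d: "0 < d" "\<And>s. s \<in> {0..1} \<Longrightarrow> dist s t < d \<Longrightarrow> \<gamma> s \<in> V"
      using continuous_map_near_real[OF c open_dom[OF V(1)] t V(2)] by metis
    have "continuation \<G> {a..b} \<gamma> (G \<circ> \<gamma>)" if "a \<le> t" "t \<le> b" "b - a < d" "0 \<le> a" "b \<le> 1" for a b
      unfolding continuation_def
    proof
      fix r assume "r \<in> {a..b}"
      have "\<forall>s\<in>{a..b}. \<bar>s - r\<bar> < 1 \<longrightarrow> \<gamma> s \<in> V \<and> (G \<circ> \<gamma>) s = G (\<gamma> s)"
        using d(2) that by (auto simp: dist_real_def)
      then show "\<exists>V G' d. \<G> V G' \<and> 0 < d \<and>
          (\<forall>s\<in>{a..b}. \<bar>s - r\<bar> < d \<longrightarrow> \<gamma> s \<in> V \<and> (G \<circ> \<gamma>) s = G' (\<gamma> s))"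
        using V(1) zero_less_one by blast
    qed
    then show "\<exists>d>0. \<forall>a b. a \<le> t \<and> t \<le> b \<and> b - a < d \<longrightarrow>
        0 \<le> a \<and> b \<le> 1 \<longrightarrow> (\<exists>F. continuation \<G> {a..b} \<gamma> F)"
      using d(1) by blast
  qed auto
  then show ?thesis by simp
qed

definition increment :: "(real \<Rightarrow> 'a) \<Rightarrow> complex" where
  "increment \<gamma> = (THE I. \<exists>F. continuation \<G> {0..1} \<gamma> F \<and> I = F 1 - F 0)"

lemma increment_eq:
  assumes "pathin X \<gamma>" "continuation \<G> {0..1} \<gamma> F"
  shows "increment \<gamma> = F 1 - F 0"
  unfolding increment_def
proof (rule the_equality)
  fix I assume "\<exists>F. continuation \<G> {0..1} \<gamma> F \<and> I = F 1 - F 0"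
  then obtain F' where F': "continuation \<G> {0..1} \<gamma> F'" "I = F' 1 - F' 0" by blast
  have "F 0 - F' 0 = F 1 - F' 1"
    by (rule continuation_unique[OF _ _ assms(2) F'(1)]) (use assms in \<open>auto simp: pathin_def\<close>)
  then show "I = F 1 - F 0" using F'(2) by (metis add.commute diff_add_cancel add_diff_eq diff_diff_eq2)
qed (use assms in blast)

lemma increment_cong:
  assumes "\<And>t. t \<in> {0..1} \<Longrightarrow> \<gamma>' t = \<gamma> t"
  shows "increment \<gamma>' = increment \<gamma>"
proof -
  have "continuation \<G> {0..1} \<gamma>' F \<longleftrightarrow> continuation \<G> {0..1} \<gamma> F" for F
    using continuation_cong[of \<G> "{0..1}" \<gamma> F \<gamma>' F] continuation_cong[of \<G> "{0..1}" \<gamma>' F \<gamma> F] assms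
    by auto
  then show ?thesis unfolding increment_def by simp
qed

end

text \<open>When the domains cover the space, every path has an increment; extended linearly to singular chains,
increments are then invariant under homology.\<close>

locale covering_local_system = local_system +
  assumes cover: "p \<in> topspace X \<Longrightarrow> \<exists>V G. \<G> V G \<and> p \<in> V"
begin

text \<open>The analogue of Goursat's argument. On a small triangle a single function of \<open>\<G>\<close> computes all three
increments, so their sum around the boundary is zero. The midpoints of the sides split a triangle into
four of half the size whose boundary sums add up to the boundary sum of the whole; doubling the size
finitely often reaches every triangle. Compactness makes the smallness uniform.\<close>

lemma increment_triangle:
  fixes S :: "'b::euclidean_space set" and s :: "'b \<Rightarrow> 'a"
  assumes S: "compact S" "convex S" and s: "continuous_map (top_of_set S) X s"
    and xyz: "x \<in> S" "y \<in> S" "z \<in> S"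
  shows "increment (s \<circ> linepath x y) + increment (s \<circ> linepath y z) = increment (s \<circ> linepath x z)"
proof -
  define J where "J x y = increment (s \<circ> linepath x y)" for x y
  have line: "linepath x y ` {0..1} \<subseteq> S" if "x \<in> S" "y \<in> S" for x y
    using S(2) that by (metis closed_segment_subset linepath_image_01)
  have path: "pathin X (s \<circ> linepath x y)" if "x \<in> S" "y \<in> S" for x y
    unfolding pathin_def
    by (rule continuous_map_compose[OF _ s])
      (use line[OF that] in \<open>auto simp: continuous_map_in_subtopology continuous_on_linepath
        image_subset_iff\<close>)
  have mid: "midpoint x y \<in> S" if "x \<in> S" "y \<in> S" for x y
    using S(2) that by (metis closed_segment_subset midpoint_in_closed_segment subsetD)
  have halve: "J x y = J x (midpoint x y) + J (midpoint x y) y" if xy: "x \<in> S" "y \<in> S" for x y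
  proof -
    obtain F where F: "continuation \<G> {0..1} (s \<circ> linepath x y) F"
      using continuation_exists[OF path[OF xy] cover] by blast
    have 1: "continuation \<G> {0..1} (s \<circ> linepath x (midpoint x y)) (\<lambda>t. F (t / 2))"
    proof (rule continuation_cong[OF continuation_compose[OF F, of "{0..1}" "\<lambda>t. t / 2"]])
      show "continuous_on {0..1} (\<lambda>t::real. t / 2)" by (intro continuous_intros) auto
      show "(s \<circ> linepath x (midpoint x y)) t = ((s \<circ> linepath x y) \<circ> (\<lambda>t. t / 2)) t" for t
      proof -
        have "linepath x (midpoint x y) t = linepath x y (t / 2)"
          by (rule euclidean_eqI) (simp add: linepath_def midpoint_def inner_simps field_simps)
        then show ?thesis by simp
      qed
    qed auto
    have 2: "continuation \<G> {0..1} (s \<circ> linepath (midpoint x y) y) (\<lambda>t. F ((t + 1) / 2))"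
    proof (rule continuation_cong[OF continuation_compose[OF F, of "{0..1}" "\<lambda>t. (t + 1) / 2"]])
      show "continuous_on {0..1} (\<lambda>t::real. (t + 1) / 2)" by (intro continuous_intros) auto
      show "(s \<circ> linepath (midpoint x y) y) t = ((s \<circ> linepath x y) \<circ> (\<lambda>t. (t + 1) / 2)) t" for t
      proof -
        have "linepath (midpoint x y) y t = linepath x y ((t + 1) / 2)"
          by (rule euclidean_eqI) (simp add: linepath_def midpoint_def inner_simps field_simps)
        then show ?thesis by simp
      qed
    qed auto
    show ?thesis
      using increment_eq[OF path[OF xy] F] increment_eq[OF path[OF xy(1) mid[OF xy]] 1]
        increment_eq[OF path[OF mid[OF xy] xy(2)] 2]
      by (simp add: J_def)
  qed
  have rev: "J y x = - J x y" if xy: "x \<in> S" "y \<in> S" for x y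
  proof -
    obtain F where F: "continuation \<G> {0..1} (s \<circ> linepath x y) F"
      using continuation_exists[OF path[OF xy] cover] by blast
    have 1: "continuation \<G> {0..1} (s \<circ> linepath y x) (\<lambda>t. F (1 - t))"
    proof (rule continuation_cong[OF continuation_compose[OF F, of "{0..1}" "\<lambda>t. 1 - t"]])
      show "continuous_on {0..1} (\<lambda>t::real. 1 - t)" by (intro continuous_intros)
      show "(s \<circ> linepath y x) t = ((s \<circ> linepath x y) \<circ> (\<lambda>t. 1 - t)) t" for t
        by (simp add: linepath_def algebra_simps)
    qed auto
    show ?thesis
      using increment_eq[OF path[OF xy] F] increment_eq[OF path[OF xy(2,1)] 1] by (simp add: J_def)
  qed
  have "\<exists>e>0. \<forall>p\<in>S. \<exists>V G. \<G> V G \<and> s ` (S \<inter> ball p e) \<subseteq> V"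
  proof -
    have "\<exists>V G U. \<G> V G \<and> open U \<and> p \<in> U \<and> s ` (S \<inter> U) \<subseteq> V" if p: "p \<in> S" for p
    proof -
      have "s p \<in> topspace X" using s p by (auto simp: continuous_map_def)
      then obtain V G where V: "\<G> V G" "s p \<in> V" using cover by blast
      have "openin (top_of_set S) {q \<in> topspace (top_of_set S). s q \<in> V}"
        using s open_dom[OF V(1)] by (rule openin_continuous_map_preimage)
      then obtain U where "open U" "{q \<in> S. s q \<in> V} = S \<inter> U"
        by (auto simp: openin_open)
      then show ?thesis using V p by blast
    qed
    then obtain V G U where VGU: "\<And>p. p \<in> S \<Longrightarrow> \<G> (V p) (G p) \<and> open (U p) \<and> p \<in> U p \<and> s ` (S \<inter> U p) \<subseteq> V p"
      by metis
    have "S \<subseteq> \<Union>(U ` S)" using VGU by blast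
    moreover have "\<And>B. B \<in> U ` S \<Longrightarrow> open B" using VGU by blast
    ultimately obtain e where e: "0 < e" "\<forall>p\<in>S. \<exists>B\<in>U ` S. ball p e \<subseteq> B"
      using Heine_Borel_lemma[OF S(1)] by metis
    have "\<exists>V G. \<G> V G \<and> s ` (S \<inter> ball p e) \<subseteq> V" if p: "p \<in> S" for p
    proof -
      obtain q where "q \<in> S" "ball p e \<subseteq> U q" using e(2) p by blast
      then have "\<G> (V q) (G q)" "s ` (S \<inter> ball p e) \<subseteq> V q" using VGU[of q] by auto
      then show ?thesis by blast
    qed
    then show ?thesis using e(1) by blast
  qed
  then obtain e where e: "e > 0" "\<And>p. p \<in> S \<Longrightarrow> \<exists>V G. \<G> V G \<and> s ` (S \<inter> ball p e) \<subseteq> V" by blast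
  have small: "J x y + J y z + J z x = 0"
    if xyz: "x \<in> S" "y \<in> S" "z \<in> S" and d: "dist x y < e" "dist x z < e" for x y z
  proof -
    obtain V G where V: "\<G> V G" "s ` (S \<inter> ball x e) \<subseteq> V" using e(2)[OF xyz(1)] by blast
    have *: "J p q = G (s q) - G (s p)" if pq: "p \<in> S \<inter> ball x e" "q \<in> S \<inter> ball x e" for p q
    proof -
      have "linepath p q ` {0..1} \<subseteq> S \<inter> ball x e"
        using pq convex_Int[OF S(2) convex_ball] by (metis closed_segment_subset linepath_image_01)
      then have "(s \<circ> linepath p q) t \<in> V" if "t \<in> {0..1}" for t
        using V(2) that by (metis comp_apply imageI subsetD)
      then have "continuation \<G> {0..1} (s \<circ> linepath p q) (\<lambda>t. G ((s \<circ> linepath p q) t))"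
        unfolding continuation_def
        by (intro ballI exI[of _ V] exI[of _ G] exI[of _ 1]) (use V(1) in auto)
      from increment_eq[OF path this] show ?thesis using pq by (simp add: J_def linepath_def)
    qed
    have "x \<in> S \<inter> ball x e" "y \<in> S \<inter> ball x e" "z \<in> S \<inter> ball x e" using xyz d e(1) by auto
    then show ?thesis by (simp add: *)
  qed
  have big: "J x y + J y z + J z x = 0"
    if "x \<in> S" "y \<in> S" "z \<in> S" "dist x y < e * 2 ^ n" "dist y z < e * 2 ^ n" "dist x z < e * 2 ^ n"
    for x y z n
    using that
  proof (induction n arbitrary: x y z)
    case 0
    then show ?case using small by simp
  next
    case (Suc n)
    let ?p = "midpoint x y" and ?q = "midpoint y z" and ?r = "midpoint x z"
    have S: "?p \<in> S" "?q \<in> S" "?r \<in> S" using Suc.prems mid by auto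
    have mids: "dist ?p ?q = dist x z / 2" "dist ?q ?r = dist x y / 2" "dist ?p ?r = dist y z / 2"
      using dist_midpoints[of y x z] dist_midpoints[of z y x] dist_midpoints[of x y z]
      by (simp_all only: midpoint_sym[of y x] midpoint_sym[of z y] midpoint_sym[of z x] dist_commute[of y x])
    note dists = mids mids[unfolded dist_commute[of ?p ?q] dist_commute[of ?q ?r] dist_commute[of ?p ?r]]
      dist_midpoint
    have half: "dist x y / 2 < e * 2 ^ n" "dist y z / 2 < e * 2 ^ n" "dist x z / 2 < e * 2 ^ n"
      using Suc.prems(4-6) by simp_all
    have sub: "J x ?p + J ?p ?r + J ?r x = 0" "J ?p y + J y ?q + J ?q ?p = 0"
      "J ?r ?q + J ?q z + J z ?r = 0" "J ?p ?q + J ?q ?r + J ?r ?p = 0"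
      using Suc.IH[of x ?p ?r] Suc.IH[of ?p y ?q] Suc.IH[of ?r ?q z] Suc.IH[of ?p ?q ?r]
      by (simp_all only: dists half Suc.prems(1-3) S simp_thms)
    have rev': "J ?r ?p = - J ?p ?r" "J ?q ?p = - J ?p ?q" "J ?r ?q = - J ?q ?r"
      using rev[OF S(1,3)] rev[OF S(1,2)] rev[OF S(2,3)] by (simp_all only:)
    have "J x y + J y z + J z x = (J x ?p + J ?p y) + (J y ?q + J ?q z) + (J z ?r + J ?r x)"
      using halve[OF Suc.prems(1,2)] halve[OF Suc.prems(2,3)] halve[OF Suc.prems(3,1)]
      by (simp only: midpoint_sym[of z x])
    also have "\<dots> = (J x ?p + J ?p ?r + J ?r x) + (J ?p y + J y ?q + J ?q ?p) +
        (J ?r ?q + J ?q z + J z ?r) + (J ?p ?q + J ?q ?r + J ?r ?p)"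
      unfolding rev' by simp
    finally show ?case by (simp only: sub add_0_left)
  qed
  \<comment> \<open>The bound \<open>e * 2 ^ n\<close> of the induction eventually exceeds the size of the given triangle.\<close>
  obtain n where "(dist x y + dist y z + dist x z) / e < 2 ^ n"
    using real_arch_pow[of 2] by auto
  then have "dist x y + dist y z + dist x z < e * 2 ^ n"
    using e(1) by (simp add: pos_divide_less_eq mult.commute)
  then have "dist x y < e * 2 ^ n" "dist y z < e * 2 ^ n" "dist x z < e * 2 ^ n"
    using zero_le_dist[of x y] zero_le_dist[of y z] zero_le_dist[of x z] by linarith+
  then have "J x y + J y z + J z x = 0" using big xyz by blast
  then show ?thesis unfolding rev[OF xyz(1,3)] unfolding J_def
    by (simp only: add_uminus_conv_diff right_minus_eq)
qed

end

section \<open>Homology invariance of increments\<close>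

text \<open>The parametrization of the standard 1-simplex that turns \<open>path_chain \<gamma>\<close> back into \<open>\<gamma>\<close>.\<close>

definition edge :: "real \<Rightarrow> nat \<Rightarrow> real" where
  "edge t = (\<lambda>i. if i = 0 then 1 - t else if i = 1 then t else 0)"

lemma edge_in_simplex: "t \<in> {0..1} \<Longrightarrow> edge t \<in> standard_simplex 1"
  by (auto simp: edge_def standard_simplex_def)

lemma singular_simplex_path:
  assumes "pathin X \<gamma>"
  shows "singular_simplex 1 X (restrict (\<lambda>x. \<gamma> (x 1)) (standard_simplex 1))"
proof -
  have "continuous_map (powertop_real UNIV) euclideanreal (\<lambda>x. x 1)"
    by (intro continuous_map_product_projection) simp
  then have "continuous_map (subtopology (powertop_real UNIV) (standard_simplex 1)) (top_of_set {0..1})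
      (\<lambda>x. x 1)"
    by (auto simp del: One_nat_def simp: continuous_map_in_subtopology standard_simplex_def
        intro!: continuous_map_from_subtopology)
  from continuous_map_compose[OF this] assms
  have "continuous_map (subtopology (powertop_real UNIV) (standard_simplex 1)) X (\<gamma> \<circ> (\<lambda>x. x 1))"
    by (simp add: pathin_def)
  then have "continuous_map (subtopology (powertop_real UNIV) (standard_simplex 1)) X
      (restrict (\<lambda>x. \<gamma> (x 1)) (standard_simplex 1))"
    by (rule continuous_map_eq) (auto simp: o_def)
  then show ?thesis by (simp add: singular_simplex_def)
qed

lemma singular_chain_path: "pathin X \<gamma> \<Longrightarrow> singular_chain 1 X (path_chain \<gamma>)"
  unfolding path_chain_def singular_chain_of by (rule singular_simplex_path)

definition point_chain :: "'a \<Rightarrow> 'a chain" where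
  "point_chain p = frag_of (restrict (\<lambda>x. p) (standard_simplex 0))"

lemma chain_boundary_path: "chain_boundary 1 (path_chain \<gamma>) = point_chain (\<gamma> 1) - point_chain (\<gamma> 0)"
proof -
  have "singular_face 1 0 (restrict (\<lambda>x. \<gamma> (x 1)) (standard_simplex 1)) = restrict (\<lambda>x. \<gamma> 1) (standard_simplex 0)"
    by (auto simp: singular_face_def simplical_face_def standard_simplex_0 standard_simplex_def fun_eq_iff)
  moreover have "singular_face 1 1 (restrict (\<lambda>x. \<gamma> (x 1)) (standard_simplex 1)) = restrict (\<lambda>x. \<gamma> 0) (standard_simplex 0)"
    by (auto simp: singular_face_def simplical_face_def standard_simplex_0 standard_simplex_def fun_eq_iff)
  ultimately show ?thesis
    by (simp add: path_chain_def chain_boundary_of point_chain_def)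
qed

lemma chain_map_path: "chain_map 1 g (path_chain \<gamma>) = path_chain (g \<circ> \<gamma>)"
  by (auto simp: path_chain_def simplex_map_def restrict_def intro!: arg_cong[where f = frag_of])

text \<open>A copy of the standard 2-simplex in the plane, because the bisection argument needs a compact
convex subset of a Euclidean space rather than of a function space.\<close>

definition triangle :: "(real \<times> real) set" where
  "triangle = {x. 0 \<le> fst x \<and> 0 \<le> snd x \<and> fst x + snd x \<le> 1}"

definition barycentric :: "real \<times> real \<Rightarrow> nat \<Rightarrow> real" where
  "barycentric x = (\<lambda>i. if i = 0 then 1 - fst x - snd x else if i = 1 then fst x else if i = 2 then snd x else 0)"

lemma compact_triangle: "compact triangle" and convex_triangle: "convex triangle"
proof -
  have eq: "triangle = cbox (0, 0) (1, 1) \<inter> {x. (1, 1) \<bullet> x \<le> (1::real)}"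
    by (auto simp: triangle_def mem_box Basis_prod_def inner_prod_def)
  show "compact triangle" unfolding eq by (intro compact_Int_closed compact_cbox closed_halfspace_le)
  show "convex triangle" unfolding eq by (intro convex_Int convex_box convex_halfspace_le)
qed

lemma barycentric_in_simplex: "x \<in> triangle \<Longrightarrow> barycentric x \<in> standard_simplex 2"
  by (auto simp: barycentric_def standard_simplex_def triangle_def numeral_2_eq_2)

lemma continuous_barycentric:
  "continuous_map (top_of_set triangle) (subtopology (powertop_real UNIV) (standard_simplex 2)) barycentric"
proof -
  have "continuous_on triangle (\<lambda>x. barycentric x i)" for i
    unfolding barycentric_def by (cases "i = 0"; cases "i = 1"; cases "i = 2") (auto intro!: continuous_intros)
  then show ?thesis
    using barycentric_in_simplex
    by (auto simp: continuous_map_in_subtopology continuous_map_componentwise_UNIV)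
qed

lemma face_edge: "t \<in> {0..1} \<Longrightarrow> singular_face 2 k f (edge t) = f (simplical_face k (edge t))"
  using edge_in_simplex[of t] by (simp add: singular_face_def)

lemma faces_barycentric:
  "simplical_face 0 (edge t) = barycentric (linepath (1, 0) (0, 1) t)"
  "simplical_face 1 (edge t) = barycentric (linepath (0, 0) (0, 1) t)"
  "simplical_face 2 (edge t) = barycentric (linepath (0, 0) (1, 0) t)"
  by (auto simp: simplical_face_def edge_def barycentric_def linepath_def fun_eq_iff)

context covering_local_system
begin

definition chain_increment :: "'a chain \<Rightarrow> complex" where
  "chain_increment c =
     (\<Sum>f\<in>Poly_Mapping.keys c. of_int (Poly_Mapping.lookup c f) * increment (f \<circ> edge))"

lemma chain_increment_superset:
  assumes "finite K" "Poly_Mapping.keys c \<subseteq> K"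
  shows "chain_increment c = (\<Sum>f\<in>K. of_int (Poly_Mapping.lookup c f) * increment (f \<circ> edge))"
  unfolding chain_increment_def using assms by (intro sum.mono_neutral_left) (auto simp: in_keys_iff)

lemma chain_increment_of: "chain_increment (frag_of f) = increment (f \<circ> edge)"
  by (simp add: chain_increment_def)

lemma chain_increment_add: "chain_increment (c + d) = chain_increment c + chain_increment d"
proof -
  let ?K = "Poly_Mapping.keys c \<union> Poly_Mapping.keys d"
  have "Poly_Mapping.keys (c + d) \<subseteq> ?K" by (rule keys_add)
  then show ?thesis
    using chain_increment_superset[of ?K c] chain_increment_superset[of ?K d]
      chain_increment_superset[of ?K "c + d"]
    by (simp add: lookup_add distrib_right sum.distrib)
qed

lemma chain_increment_cmul: "chain_increment (frag_cmul n c) = of_int n * chain_increment c"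
  using chain_increment_superset[of "Poly_Mapping.keys c" "frag_cmul n c"] keys_cmul[of n c]
  by (simp add: chain_increment_def sum_distrib_left mult.assoc)

lemma chain_increment_minus: "chain_increment (- c) = - chain_increment c"
  using chain_increment_cmul[of "-1" c] by simp

lemma chain_increment_diff: "chain_increment (c - d) = chain_increment c - chain_increment d"
  using chain_increment_add[of c "- d"] by (simp add: chain_increment_minus)

lemma chain_increment_0: "chain_increment 0 = 0"
  by (simp add: chain_increment_def)

lemma chain_increment_sum: "chain_increment (\<Sum>i\<in>I. c i) = (\<Sum>i\<in>I. chain_increment (c i))"
  by (induction I rule: infinite_finite_induct) (simp_all add: chain_increment_0 chain_increment_add)

lemma chain_increment_path: "chain_increment (path_chain \<gamma>) = increment \<gamma>"
  unfolding path_chain_def chain_increment_of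
proof (rule increment_cong)
  fix t :: real assume "t \<in> {0..1}"
  then have "edge t \<in> standard_simplex 1" by (rule edge_in_simplex)
  then show "(restrict (\<lambda>x. \<gamma> (x 1)) (standard_simplex 1) \<circ> edge) t = \<gamma> t"
    by (simp add: edge_def)
qed

text \<open>The three faces are the sides of the triangle, with the signs that make the triangle identity for
increments say that the boundary sum vanishes.\<close>

lemma chain_increment_boundary_simplex:
  assumes f: "singular_simplex 2 X f"
  shows "chain_increment (chain_boundary 2 (frag_of f)) = 0"
proof -
  define s where "s = f \<circ> barycentric"
  have s: "continuous_map (top_of_set triangle) X s"
    unfolding s_def using f
    by (intro continuous_map_compose[OF continuous_barycentric]) (simp add: singular_simplex_def)
  have faces: "increment (singular_face 2 0 f \<circ> edge) = increment (s \<circ> linepath (1, 0) (0, 1))"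
    "increment (singular_face 2 1 f \<circ> edge) = increment (s \<circ> linepath (0, 0) (0, 1))"
    "increment (singular_face 2 2 f \<circ> edge) = increment (s \<circ> linepath (0, 0) (1, 0))"
    by (rule increment_cong, simp add: s_def face_edge faces_barycentric[unfolded One_nat_def])+
  have "chain_boundary 2 (frag_of f) =
      frag_of (singular_face 2 0 f) - frag_of (singular_face 2 1 f) + frag_of (singular_face 2 2 f)"
    by (simp add: chain_boundary_of numeral_2_eq_2)
  then have "chain_increment (chain_boundary 2 (frag_of f)) =
      increment (s \<circ> linepath (1, 0) (0, 1)) - increment (s \<circ> linepath (0, 0) (0, 1)) +
      increment (s \<circ> linepath (0, 0) (1, 0))"
    by (simp add: chain_increment_add chain_increment_diff chain_increment_of faces[unfolded One_nat_def])
  also have "\<dots> = 0"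
    using increment_triangle[OF compact_triangle convex_triangle s, of "(0, 0)" "(1, 0)" "(0, 1)"]
    by (simp add: triangle_def algebra_simps)
  finally show ?thesis .
qed

lemma chain_increment_boundary:
  assumes "singular_chain 2 X c"
  shows "chain_increment (chain_boundary 2 c) = 0"
  using assms unfolding singular_chain_def
proof (induction c rule: frag_induction)
  case (one f)
  then show ?case using chain_increment_boundary_simplex by simp
qed (simp_all add: chain_increment_0 chain_boundary_diff chain_increment_diff)

text \<open>Homology invariance of increments, hence also of the periods of differentials of the second kind.\<close>

lemma chain_increment_homologous:
  assumes "homologous_rel 1 X {} c d"
  shows "chain_increment c = chain_increment d"
proof -
  have "singular_relboundary 1 X {} (c - d)" using assms by (simp add: homologous_rel_def)
  then obtain b where "singular_chain 2 X b" "chain_boundary 2 b = c - d"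
    by (auto simp: singular_boundary numeral_2_eq_2)
  then have "chain_increment (c - d) = 0" using chain_increment_boundary by metis
  then show ?thesis by (simp add: chain_increment_diff)
qed

end

section \<open>Primitives of differentials on Riemann surfaces\<close>

context
  fixes R :: "'a surface"
  assumes R: "riemann_surface R"
begin

lemma chart_exists: "p \<in> topspace (pts R) \<Longrightarrow> \<exists>\<kappa>\<in>atlas R. p \<in> fst \<kappa>"
  using R unfolding riemann_surface_def by blast

lemma chart_at: "p \<in> topspace (pts R) \<Longrightarrow> chart_at R p \<in> atlas R \<and> p \<in> fst (chart_at R p)"
  unfolding chart_at_def by (rule someI_ex) (use chart_exists in blast)

lemma chart_open: "\<kappa> \<in> atlas R \<Longrightarrow> openin (pts R) (fst \<kappa>)"
  and chart_image: "\<kappa> \<in> atlas R \<Longrightarrow> open (snd \<kappa> ` fst \<kappa>)"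
  and chart_homeomorphic: "\<kappa> \<in> atlas R \<Longrightarrow>
    homeomorphic_map (subtopology (pts R) (fst \<kappa>)) (top_of_set (snd \<kappa> ` fst \<kappa>)) (snd \<kappa>)"
  and transition_holomorphic: "\<kappa> \<in> atlas R \<Longrightarrow> \<kappa>' \<in> atlas R \<Longrightarrow>
    (snd \<kappa>' \<circ> chart_inv \<kappa>) holomorphic_on (snd \<kappa> ` (fst \<kappa> \<inter> fst \<kappa>'))"
  using R unfolding riemann_surface_def by blast+

lemma chart_inv_left:
  assumes "\<kappa> \<in> atlas R" "p \<in> fst \<kappa>"
  shows "chart_inv \<kappa> (snd \<kappa> p) = p"
proof -
  have "fst \<kappa> \<subseteq> topspace (pts R)" using chart_open[OF assms(1)] by (rule openin_subset)
  then have "inj_on (snd \<kappa>) (fst \<kappa>)"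
    using homeomorphic_imp_injective_map[OF chart_homeomorphic[OF assms(1)]]
    by (simp add: Int_absorb1)
  then show ?thesis using assms(2) by (simp add: chart_inv_def)
qed

lemma chart_image_open:
  assumes "\<kappa> \<in> atlas R" "openin (pts R) V"
  shows "open (snd \<kappa> ` (fst \<kappa> \<inter> V))"
proof -
  have "openin (subtopology (pts R) (fst \<kappa>)) (fst \<kappa> \<inter> V)"
    using assms(2) by (auto simp: openin_subtopology)
  then have "openin (top_of_set (snd \<kappa> ` fst \<kappa>)) (snd \<kappa> ` (fst \<kappa> \<inter> V))"
    using homeomorphic_imp_open_map[OF chart_homeomorphic[OF assms(1)]] by (simp add: open_map_def)
  then show ?thesis using chart_image[OF assms(1)] openin_open_trans by blast
qed

lemma chart_preimage_open:
  assumes "\<kappa> \<in> atlas R" "open B"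
  shows "openin (pts R) {p \<in> fst \<kappa>. snd \<kappa> p \<in> B}"
proof -
  have "continuous_map (subtopology (pts R) (fst \<kappa>)) euclidean (snd \<kappa>)"
    using homeomorphic_imp_continuous_map[OF chart_homeomorphic[OF assms(1)]]
    by (simp add: continuous_map_in_subtopology)
  from openin_continuous_map_preimage[OF this, of B]
  have "openin (subtopology (pts R) (fst \<kappa>)) {p \<in> topspace (pts R) \<inter> fst \<kappa>. snd \<kappa> p \<in> B}"
    using assms(2) by simp
  moreover have "topspace (pts R) \<inter> fst \<kappa> = fst \<kappa>"
    using openin_subset[OF chart_open[OF assms(1)]] by blast
  ultimately show ?thesis using chart_open[OF assms(1)] openin_trans_full by simp
qed

lemma chart_disc:
  assumes "\<kappa> \<in> atlas R" "openin (pts R) V" "p \<in> V" "p \<in> fst \<kappa>"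
  obtains r where "0 < r" "ball (snd \<kappa> p) r \<subseteq> snd \<kappa> ` (fst \<kappa> \<inter> V)"
  using chart_image_open[OF assms(1,2)] assms(3,4) by (meson IntI image_eqI openE)

lemma openin_delete_point:
  assumes "openin (pts R) V"
  shows "openin (pts R) (V - {q})"
proof (cases "q \<in> V")
  case True
  then have "closedin (pts R) {q}"
    using R openin_subset[OF assms] by (auto simp: riemann_surface_def intro: closedin_Hausdorff_singleton)
  then show ?thesis using assms by (rule openin_diff[rotated])
qed (use assms in simp)

lemma holomorphic_diff_on_subset:
  assumes "holomorphic_diff_on R V \<omega>" "W \<subseteq> V"
  shows "holomorphic_diff_on R W \<omega>"
proof -
  have "(\<omega> \<kappa> \<circ> chart_inv \<kappa>) holomorphic_on (snd \<kappa> ` (fst \<kappa> \<inter> W))" if "\<kappa> \<in> atlas R" for \<kappa>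
    by (rule holomorphic_on_subset[of _ "snd \<kappa> ` (fst \<kappa> \<inter> V)"])
      (use assms that in \<open>auto simp: holomorphic_diff_on_def\<close>)
  then show ?thesis using assms unfolding holomorphic_diff_on_def differential_on_def by blast
qed

lemma has_derivative_in_chart_cong:
  assumes "\<kappa> \<in> atlas R" "openin (pts R) V" "p \<in> V" "p \<in> fst \<kappa>"
    and "((G \<circ> chart_inv \<kappa>) has_field_derivative D) (at (snd \<kappa> p))"
    and "\<And>q. q \<in> V \<Longrightarrow> q \<in> fst \<kappa> \<Longrightarrow> G q = G' q"
  shows "((G' \<circ> chart_inv \<kappa>) has_field_derivative D) (at (snd \<kappa> p))"
proof (rule has_field_derivative_transform_within_open[OF assms(5) chart_image_open[OF assms(1,2)]])
  show "snd \<kappa> p \<in> snd \<kappa> ` (fst \<kappa> \<inter> V)" using assms by blast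
  show "(G \<circ> chart_inv \<kappa>) w = (G' \<circ> chart_inv \<kappa>) w" if "w \<in> snd \<kappa> ` (fst \<kappa> \<inter> V)" for w
    using that assms(6) chart_inv_left[OF assms(1)] by auto
qed

lemma transition_derivative:
  assumes "\<kappa> \<in> atlas R" "\<kappa>' \<in> atlas R" "p \<in> fst \<kappa>" "p \<in> fst \<kappa>'"
  shows "((snd \<kappa>' \<circ> chart_inv \<kappa>) has_field_derivative
    deriv (snd \<kappa>' \<circ> chart_inv \<kappa>) (snd \<kappa> p)) (at (snd \<kappa> p))"
  by (rule holomorphic_derivI[OF transition_holomorphic[OF assms(1,2)]])
    (use assms chart_image_open[OF assms(1) chart_open[OF assms(2)]] in auto)

lemma primitive_on_subset:
  "primitive_on R V G \<omega> \<Longrightarrow> openin (pts R) W \<Longrightarrow> W \<subseteq> V \<Longrightarrow> primitive_on R W G \<omega>"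
  unfolding primitive_on_def by blast

lemma primitive_on_cong:
  assumes "primitive_on R V G \<omega>" "\<And>p. p \<in> V \<Longrightarrow> G p = G' p"
    "\<And>\<kappa> p. \<kappa> \<in> atlas R \<Longrightarrow> p \<in> V \<Longrightarrow> p \<in> fst \<kappa> \<Longrightarrow> \<omega> \<kappa> p = \<omega>' \<kappa> p"
  shows "primitive_on R V G' \<omega>'"
  unfolding primitive_on_def
proof (intro conjI ballI)
  show V: "openin (pts R) V" using assms(1) by (simp add: primitive_on_def)
  fix \<kappa> p assume p: "\<kappa> \<in> atlas R" "p \<in> V \<inter> fst \<kappa>"
  then have "((G \<circ> chart_inv \<kappa>) has_field_derivative \<omega>' \<kappa> p) (at (snd \<kappa> p))"
    using assms(1) assms(3)[of \<kappa> p] unfolding primitive_on_def by (metis IntE)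
  then show "((G' \<circ> chart_inv \<kappa>) has_field_derivative \<omega>' \<kappa> p) (at (snd \<kappa> p))"
    by (rule has_derivative_in_chart_cong[OF p(1) V, rotated 2]) (use p assms(2) in auto)
qed

lemma primitive_on_add:
  assumes "primitive_on R V G \<omega>" "primitive_on R V G' \<omega>'"
  shows "primitive_on R V (\<lambda>p. G p + G' p) (\<lambda>\<kappa> p. \<omega> \<kappa> p + \<omega>' \<kappa> p)"
  using assms by (auto simp: primitive_on_def o_def intro!: DERIV_add)

lemma primitive_on_add_const: "primitive_on R V G \<omega> \<Longrightarrow> primitive_on R V (\<lambda>p. G p + c) \<omega>"
  using DERIV_add[OF _ DERIV_const[of c]] by (fastforce simp: primitive_on_def o_def)

text \<open>In one chart a primitive exists on a disc because holomorphic functions on convex sets have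
primitives; the transformation law of differentials makes it a primitive in all other charts.\<close>

lemma local_primitive_exists:
  assumes \<omega>: "holomorphic_diff_on R V \<omega>" and V: "openin (pts R) V" "p \<in> V"
  shows "\<exists>W G. primitive_on R W G \<omega> \<and> p \<in> W \<and> W \<subseteq> V"
proof -
  have "p \<in> topspace (pts R)" using openin_subset[OF V(1)] V(2) by blast
  then obtain \<kappa> where \<kappa>: "\<kappa> \<in> atlas R" "p \<in> fst \<kappa>" using chart_exists by blast
  obtain r where r: "0 < r" "ball (snd \<kappa> p) r \<subseteq> snd \<kappa> ` (fst \<kappa> \<inter> V)"
    using chart_disc[OF \<kappa>(1) V \<kappa>(2)] by blast
  have "(\<omega> \<kappa> \<circ> chart_inv \<kappa>) holomorphic_on ball (snd \<kappa> p) r"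
    using \<omega> \<kappa>(1) r(2) unfolding holomorphic_diff_on_def by (meson holomorphic_on_subset)
  then obtain h where h: "\<And>w. w \<in> ball (snd \<kappa> p) r \<Longrightarrow>
      (h has_field_derivative (\<omega> \<kappa> \<circ> chart_inv \<kappa>) w) (at w within ball (snd \<kappa> p) r)"
    using holomorphic_convex_primitive'[OF convex_ball open_ball] by blast
  define W where "W = {q \<in> fst \<kappa>. snd \<kappa> q \<in> ball (snd \<kappa> p) r}"
  have W: "openin (pts R) W" unfolding W_def by (rule chart_preimage_open[OF \<kappa>(1) open_ball])
  have WV: "q \<in> V" if "q \<in> W" for q
  proof -
    have "snd \<kappa> q \<in> snd \<kappa> ` (fst \<kappa> \<inter> V)" using that r(2) by (auto simp: W_def)
    then obtain q' where "q' \<in> fst \<kappa> \<inter> V" "snd \<kappa> q = snd \<kappa> q'" by blast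
    moreover have "q \<in> fst \<kappa>" using that by (simp add: W_def)
    ultimately have "q = q'" using chart_inv_left[OF \<kappa>(1)] by (metis IntE)
    then show ?thesis using \<open>q' \<in> fst \<kappa> \<inter> V\<close> by simp
  qed
  have "((h \<circ> snd \<kappa> \<circ> chart_inv \<kappa>') has_field_derivative \<omega> \<kappa>' q) (at (snd \<kappa>' q))"
    if q: "\<kappa>' \<in> atlas R" "q \<in> W \<inter> fst \<kappa>'" for \<kappa>' q
  proof -
    have q\<kappa>: "q \<in> fst \<kappa>" "snd \<kappa> q \<in> ball (snd \<kappa> p) r" using q by (auto simp: W_def)
    have "(h has_field_derivative \<omega> \<kappa> q) (at (snd \<kappa> q))"
      using h[OF q\<kappa>(2)] at_within_open[OF q\<kappa>(2) open_ball] chart_inv_left[OF \<kappa>(1) q\<kappa>(1)] by simp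
    then have "(h has_field_derivative \<omega> \<kappa> q) (at ((snd \<kappa> \<circ> chart_inv \<kappa>') (snd \<kappa>' q)))"
      using chart_inv_left[OF q(1)] q by simp
    from DERIV_chain[OF this transition_derivative[OF q(1) \<kappa>(1) _ q\<kappa>(1)]]
    have "((h \<circ> (snd \<kappa> \<circ> chart_inv \<kappa>')) has_field_derivative
        \<omega> \<kappa> q * deriv (snd \<kappa> \<circ> chart_inv \<kappa>') (snd \<kappa>' q)) (at (snd \<kappa>' q))"
      using q by simp
    moreover have "\<omega> \<kappa>' q = \<omega> \<kappa> q * deriv (snd \<kappa> \<circ> chart_inv \<kappa>') (snd \<kappa>' q)"
      using \<omega> q \<kappa>(1) q\<kappa>(1) WV unfolding holomorphic_diff_on_def differential_on_def by blast
    ultimately show ?thesis by (simp add: o_assoc)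
  qed
  then have "primitive_on R W (h \<circ> snd \<kappa>) \<omega>" using W by (simp add: primitive_on_def)
  moreover have "p \<in> W" using \<kappa>(2) r(1) by (simp add: W_def)
  ultimately show ?thesis using WV by blast
qed

lemma primitives_differ_by_constant:
  assumes G: "primitive_on R V G \<omega>" "primitive_on R V' G' \<omega>" and p: "p \<in> V" "p \<in> V'"
  shows "\<exists>W. openin (pts R) W \<and> p \<in> W \<and> (\<forall>q\<in>W. G q - G' q = G p - G' p)"
proof -
  have V: "openin (pts R) (V \<inter> V')" using G by (auto simp: primitive_on_def)
  have "p \<in> topspace (pts R)" using openin_subset[OF V] p by blast
  then obtain \<kappa> where \<kappa>: "\<kappa> \<in> atlas R" "p \<in> fst \<kappa>" using chart_exists by blast
  obtain r where r: "0 < r" "ball (snd \<kappa> p) r \<subseteq> snd \<kappa> ` (fst \<kappa> \<inter> (V \<inter> V'))"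
    using chart_disc[OF \<kappa>(1) V _ \<kappa>(2)] p by blast
  define D where "D = (\<lambda>w. (G \<circ> chart_inv \<kappa>) w - (G' \<circ> chart_inv \<kappa>) w)"
  have "(D has_field_derivative 0) (at w within ball (snd \<kappa> p) r)" if w: "w \<in> ball (snd \<kappa> p) r" for w
  proof -
    obtain q where q: "q \<in> fst \<kappa>" "q \<in> V" "q \<in> V'" "w = snd \<kappa> q" using w r(2) by blast
    have "((G \<circ> chart_inv \<kappa>) has_field_derivative \<omega> \<kappa> q) (at w)"
      "((G' \<circ> chart_inv \<kappa>) has_field_derivative \<omega> \<kappa> q) (at w)"
      using G q \<kappa>(1) by (auto simp: primitive_on_def)
    from DERIV_diff[OF this] show ?thesis
      unfolding D_def by (auto intro: has_field_derivative_at_within)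
  qed
  then obtain c where c: "\<And>w. w \<in> ball (snd \<kappa> p) r \<Longrightarrow> D w = c"
    using has_field_derivative_zero_constant[OF convex_ball] by metis
  define W where "W = {q \<in> fst \<kappa>. snd \<kappa> q \<in> ball (snd \<kappa> p) r}"
  have "G q - G' q = c" if "q \<in> W" for q
    using c[of "snd \<kappa> q"] that chart_inv_left[OF \<kappa>(1)] by (auto simp: W_def D_def)
  moreover have "p \<in> W" using \<kappa>(2) r(1) by (simp add: W_def)
  moreover have "openin (pts R) W" unfolding W_def by (rule chart_preimage_open[OF \<kappa>(1) open_ball])
  ultimately show ?thesis by metis
qed

lemma local_system_primitives: "local_system (pts R) (\<lambda>V G. primitive_on R V G \<omega>)"
proof
  show "openin (pts R) V" if "primitive_on R V G \<omega>" for V G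
    using that by (simp add: primitive_on_def)
  show "primitive_on R V (\<lambda>p. G p + c) \<omega>" if "primitive_on R V G \<omega>" for V G c
    using that by (rule primitive_on_add_const)
  show "\<exists>W. openin (pts R) W \<and> p \<in> W \<and> (\<forall>q\<in>W. G q - G' q = G p - G' p)"
    if "primitive_on R V G \<omega>" "primitive_on R V' G' \<omega>" "p \<in> V" "p \<in> V'" for V G V' G' p
    using that by (rule primitives_differ_by_constant)
qed

lemma primitive_along_iff_continuation:
  "primitive_along R T \<omega> \<gamma> F \<longleftrightarrow> continuation (\<lambda>V G. primitive_on R V G \<omega>) T \<gamma> F"
  unfolding primitive_along_def continuation_def by blast

text \<open>The path integral is defined by a definite description, so computing it needs uniqueness: two
primitives along the same path differ by a constant.\<close>

lemma path_integral_eq: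
  assumes "pathin (pts R) \<gamma>" "primitive_along R {0..1} \<omega> \<gamma> F"
  shows "path_integral R \<omega> \<gamma> = F 1 - F 0"
  using local_system.increment_eq[OF local_system_primitives assms(1), of \<omega> F] assms(2)
  by (simp add: path_integral_def local_system.increment_def[OF local_system_primitives]
      primitive_along_iff_continuation)

lemma primitive_continuous:
  assumes G: "primitive_on R V G \<omega>" and p: "p \<in> V" and e: "0 < e"
  shows "\<exists>W. openin (pts R) W \<and> p \<in> W \<and> W \<subseteq> V \<and> (\<forall>q\<in>W. dist (G q) (G p) < e)"
proof -
  have V: "openin (pts R) V" using G by (simp add: primitive_on_def)
  have "p \<in> topspace (pts R)" using openin_subset[OF V] p by blast
  then obtain \<kappa> where \<kappa>: "\<kappa> \<in> atlas R" "p \<in> fst \<kappa>" using chart_exists by blast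
  have "isCont (G \<circ> chart_inv \<kappa>) (snd \<kappa> p)"
    using G p \<kappa> by (auto simp: primitive_on_def intro: DERIV_isCont)
  then obtain d where d: "0 < d" "\<And>w. dist w (snd \<kappa> p) < d \<Longrightarrow>
      dist ((G \<circ> chart_inv \<kappa>) w) ((G \<circ> chart_inv \<kappa>) (snd \<kappa> p)) < e"
    using e unfolding continuous_at_eps_delta by metis
  have "openin (pts R) ({q \<in> fst \<kappa>. snd \<kappa> q \<in> ball (snd \<kappa> p) d} \<inter> V)"
    by (intro openin_Int chart_preimage_open \<kappa> open_ball V)
  moreover have "dist (G q) (G p) < e" if "q \<in> fst \<kappa>" "snd \<kappa> q \<in> ball (snd \<kappa> p) d" for q
    using d(2)[of "snd \<kappa> q"] that chart_inv_left \<kappa> by (simp add: dist_commute)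
  ultimately show ?thesis
    by (intro exI[of _ "{q \<in> fst \<kappa>. snd \<kappa> q \<in> ball (snd \<kappa> p) d} \<inter> V"]) (use p \<kappa> d in auto)
qed

text \<open>Near its pole a differential of the second kind is \<open>du\<close> plus a holomorphic differential \<open>\<theta>\<close>. The
neighbourhood is shrunk until the local parameter \<open>1/u\<close> has no zero besides \<open>q\<close>, so that \<open>u\<close> is
differentiable off \<open>q\<close> and hence a primitive of \<open>\<Omega> - \<theta>\<close> there.\<close>

lemma second_kind_local_form:
  assumes k: "local_parameter R (\<lambda>p. inverse (u p)) q" and \<Omega>: "second_kind R \<Omega> u q"
    and q: "q \<in> topspace (pts R)"
  shows "\<exists>N \<theta>. openin (pts R) N \<and> q \<in> N \<and> holomorphic_diff_on R N \<theta> \<and>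
    primitive_on R (N - {q}) u (\<lambda>\<kappa> p. \<Omega> \<kappa> p - \<theta> \<kappa> p)"
proof -
  obtain V \<theta> where V: "openin (pts R) V" "q \<in> V" "holomorphic_diff_on R V \<theta>"
    and \<theta>: "\<And>\<kappa> p. \<kappa> \<in> atlas R \<Longrightarrow> p \<in> V \<inter> fst \<kappa> - {q} \<Longrightarrow> \<Omega> \<kappa> p = d_fun u \<kappa> p + \<theta> \<kappa> p"
    using \<Omega> unfolding second_kind_def by metis
  obtain V' where V': "openin (pts R) V'" "q \<in> V'"
    and hol: "\<And>\<kappa>. \<kappa> \<in> atlas R \<Longrightarrow> ((\<lambda>p. inverse (u p)) \<circ> chart_inv \<kappa>) holomorphic_on (snd \<kappa> ` (fst \<kappa> \<inter> V'))"
    and nz: "\<And>\<kappa>. \<kappa> \<in> atlas R \<Longrightarrow> q \<in> fst \<kappa> \<Longrightarrow> deriv ((\<lambda>p. inverse (u p)) \<circ> chart_inv \<kappa>) (snd \<kappa> q) \<noteq> 0"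
    and uq: "inverse (u q) = 0"
    using k unfolding local_parameter_def by metis
  obtain \<kappa> where \<kappa>: "\<kappa> \<in> atlas R" "q \<in> fst \<kappa>" using chart_exists[OF q] by blast
  let ?k = "(\<lambda>p. inverse (u p)) \<circ> chart_inv \<kappa>"
  have "(?k has_field_derivative deriv ?k (snd \<kappa> q)) (at (snd \<kappa> q))"
    by (rule holomorphic_derivI[OF hol[OF \<kappa>(1)] chart_image_open[OF \<kappa>(1) V'(1)]]) (use V' \<kappa> in auto)
  then have "((\<lambda>w. (?k w - ?k (snd \<kappa> q)) / (w - snd \<kappa> q)) \<longlongrightarrow> deriv ?k (snd \<kappa> q)) (at (snd \<kappa> q))"
    by (simp add: has_field_derivative_iff)
  then have "\<forall>\<^sub>F w in at (snd \<kappa> q). (?k w - ?k (snd \<kappa> q)) / (w - snd \<kappa> q) \<noteq> 0"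
    using nz[OF \<kappa>] by (rule tendsto_imp_eventually_ne)
  moreover have "?k (snd \<kappa> q) = 0" using uq chart_inv_left[OF \<kappa>] by simp
  ultimately obtain d where d: "0 < d"
    "\<And>w. w \<noteq> snd \<kappa> q \<Longrightarrow> dist w (snd \<kappa> q) < d \<Longrightarrow> ?k w \<noteq> 0"
    unfolding eventually_at by auto
  define N where "N = {p \<in> fst \<kappa>. snd \<kappa> p \<in> ball (snd \<kappa> q) d} \<inter> (V \<inter> V')"
  have N: "openin (pts R) N" unfolding N_def
    by (intro openin_Int chart_preimage_open \<kappa> open_ball V V')
  have qN: "q \<in> N" using d V V' \<kappa> by (auto simp: N_def)
  have u: "u p \<noteq> 0" if p: "p \<in> N - {q}" for p
  proof -
    have p\<kappa>: "p \<in> fst \<kappa>" "p \<noteq> q" using p by (auto simp: N_def)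
    then have "snd \<kappa> p \<noteq> snd \<kappa> q"
      using chart_inv_left[OF \<kappa>(1) p\<kappa>(1)] chart_inv_left[OF \<kappa>] by metis
    then show ?thesis using d(2)[of "snd \<kappa> p"] p chart_inv_left[OF \<kappa>(1)]
      by (auto simp: N_def dist_commute)
  qed
  have "primitive_on R (N - {q}) u (\<lambda>\<kappa> p. \<Omega> \<kappa> p - \<theta> \<kappa> p)"
    unfolding primitive_on_def
  proof (intro conjI ballI)
    show "openin (pts R) (N - {q})" using N by (rule openin_delete_point)
    fix \<kappa>' p assume \<kappa>': "\<kappa>' \<in> atlas R" and p: "p \<in> (N - {q}) \<inter> fst \<kappa>'"
    let ?k' = "(\<lambda>p. inverse (u p)) \<circ> chart_inv \<kappa>'"
    have D: "(?k' has_field_derivative deriv ?k' (snd \<kappa>' p)) (at (snd \<kappa>' p))"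
      by (rule holomorphic_derivI[OF hol[OF \<kappa>'] chart_image_open[OF \<kappa>' V'(1)]])
        (use p in \<open>auto simp: N_def\<close>)
    have "?k' (snd \<kappa>' p) \<noteq> 0" using u p chart_inv_left[OF \<kappa>'] by auto
    from DERIV_inverse'[OF D this]
    obtain c where "((\<lambda>w. inverse (?k' w)) has_field_derivative c) (at (snd \<kappa>' p))" by blast
    then have c: "((u \<circ> chart_inv \<kappa>') has_field_derivative c) (at (snd \<kappa>' p))" by (simp add: o_def)
    then have "d_fun u \<kappa>' p = c" by (simp add: d_fun_def DERIV_imp_deriv)
    then have "c = \<Omega> \<kappa>' p - \<theta> \<kappa>' p" using \<theta>[OF \<kappa>', of p] p by (auto simp: N_def)
    then show "((u \<circ> chart_inv \<kappa>') has_field_derivative \<Omega> \<kappa>' p - \<theta> \<kappa>' p) (at (snd \<kappa>' p))" using c by simp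
  qed
  moreover have "holomorphic_diff_on R N \<theta>"
    by (rule holomorphic_diff_on_subset[OF V(3)]) (auto simp: N_def)
  ultimately show ?thesis using N qN by blast
qed

end

section \<open>Differentials of the second kind\<close>

text \<open>A differential \<open>\<Omega>\<close> holomorphic off \<open>q\<close>, equal to \<open>du + \<theta>\<close> near \<open>q\<close>. Since its polar part is exact, it
has no residue, and its periods are homology invariants of the full surface, not only
of the surface punctured at \<open>q\<close>.\<close>

locale pole_datum =
  fixes R :: "'a surface" and \<Omega> :: "'a differential" and u :: "'a \<Rightarrow> complex" and q :: 'a
    and N :: "'a set" and \<theta> :: "'a differential"
  assumes R: "riemann_surface R"
    and N: "openin (pts R) N" "q \<in> N"
    and \<theta>: "holomorphic_diff_on R N \<theta>"
    and \<Omega>: "holomorphic_diff_on R (topspace (pts R) - {q}) \<Omega>"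
    and u: "primitive_on R (N - {q}) u (\<lambda>\<kappa> p. \<Omega> \<kappa> p - \<theta> \<kappa> p)"
begin

text \<open>Cutting off \<open>u\<close> makes it discontinuous. This is harmless: all functions of the family below that live
off \<open>q\<close> subtract the same \<open>pole_part\<close>, so it cancels from their differences.\<close>

definition pole_part :: "'a \<Rightarrow> complex" where
  "pole_part p = (if p \<in> N - {q} then u p else 0)"

text \<open>The local primitives of \<open>\<Omega> - d(pole_part)\<close>, a class that has no singularity at \<open>q\<close>: there it is
represented by primitives of \<open>\<theta>\<close>. Continuation through this family makes sense for paths that pass
through \<open>q\<close>, and for singular simplices that cover \<open>q\<close>.\<close>

definition regular :: "'a set \<Rightarrow> ('a \<Rightarrow> complex) \<Rightarrow> bool" where
  "regular V G \<longleftrightarrow> q \<notin> V \<and> primitive_on R V (\<lambda>p. G p + pole_part p) \<Omega> \<or> V \<subseteq> N \<and> primitive_on R V G \<theta>"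

lemma regular_punctured:
  assumes "regular V G"
  shows "primitive_on R (V - {q}) (\<lambda>p. G p + pole_part p) \<Omega>"
  using assms unfolding regular_def
proof (elim disjE conjE)
  assume G: "V \<subseteq> N" "primitive_on R V G \<theta>"
  then have V: "openin (pts R) (V - {q})"
    using openin_delete_point[OF R] by (simp add: primitive_on_def)
  have "primitive_on R (V - {q}) (\<lambda>p. G p + u p) (\<lambda>\<kappa> p. \<theta> \<kappa> p + (\<Omega> \<kappa> p - \<theta> \<kappa> p))"
    by (rule primitive_on_add[OF R primitive_on_subset[OF R G(2) V] primitive_on_subset[OF R u V]])
      (use G in auto)
  then show ?thesis
    by (rule primitive_on_cong[OF R]) (use G in \<open>auto simp: pole_part_def\<close>)
qed simp

lemma regular_awayI:
  "primitive_on R V G \<Omega> \<Longrightarrow> q \<notin> V \<Longrightarrow> regular V (\<lambda>p. G p - pole_part p)"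
  unfolding regular_def by simp

sublocale covering_local_system "pts R" regular
proof
  show "openin (pts R) V" if "regular V G" for V G
    using that by (auto simp: regular_def primitive_on_def)
  show "regular V (\<lambda>p. G p + c)" if "regular V G" for V G c
  proof -
    have "(\<lambda>p. G p + c + pole_part p) = (\<lambda>p. G p + pole_part p + c)" by (simp add: add_ac)
    then show ?thesis
      using that primitive_on_add_const[OF R, of V _ _ c] unfolding regular_def by metis
  qed
  show "\<exists>W. openin (pts R) W \<and> p \<in> W \<and> (\<forall>r\<in>W. G r - G' r = G p - G' p)"
    if G: "regular V G" "regular V' G'" and p: "p \<in> V" "p \<in> V'" for V G V' G' p
  proof (cases "p = q")
    case True
    then have "primitive_on R V G \<theta>" "primitive_on R V' G' \<theta>"
      using G p by (auto simp: regular_def)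
    then show ?thesis using p by (rule primitives_differ_by_constant[OF R])
  next
    case False
    then show ?thesis
      using primitives_differ_by_constant[OF R regular_punctured[OF G(1)] regular_punctured[OF G(2)], of p] p
      by simp
  qed
  show "\<exists>V G. regular V G \<and> p \<in> V" if p: "p \<in> topspace (pts R)" for p
  proof (cases "p = q")
    case True
    then obtain W G where "primitive_on R W G \<theta>" "p \<in> W" "W \<subseteq> N"
      using local_primitive_exists[OF R \<theta> N] by blast
    then show ?thesis by (auto simp: regular_def)
  next
    case False
    then obtain W G where "primitive_on R W G \<Omega>" "p \<in> W" "W \<subseteq> topspace (pts R) - {q}"
      using local_primitive_exists[OF R \<Omega> openin_delete_point[OF R openin_topspace]] p by blast
    then show ?thesis using regular_awayI[of W G] by blast
  qed
qed

lemma primitive_along_of_continuation: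
  assumes "continuation regular T \<gamma> F" "\<And>t. t \<in> T \<Longrightarrow> \<gamma> t \<noteq> q"
  shows "primitive_along R T \<Omega> \<gamma> (\<lambda>t. F t + pole_part (\<gamma> t))"
  unfolding primitive_along_def
proof
  fix t assume "t \<in> T"
  then obtain V G d where V: "regular V G" "0 < d"
    and d: "\<forall>s\<in>T. \<bar>s - t\<bar> < d \<longrightarrow> \<gamma> s \<in> V \<and> F s = G (\<gamma> s)"
    using assms(1) unfolding continuation_def by metis
  have "\<forall>s\<in>T. \<bar>s - t\<bar> < d \<longrightarrow> \<gamma> s \<in> V - {q} \<and> F s + pole_part (\<gamma> s) = G (\<gamma> s) + pole_part (\<gamma> s)"
    using d assms(2) by simp
  then show "\<exists>V G d. primitive_on R V G \<Omega> \<and> 0 < d \<and>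
      (\<forall>s\<in>T. \<bar>s - t\<bar> < d \<longrightarrow> \<gamma> s \<in> V \<and> F s + pole_part (\<gamma> s) = G (\<gamma> s))"
    using regular_punctured[OF V(1)] V(2) by blast
qed

text \<open>For a closed path the boundary terms cancel, so that the period of \<open>\<Omega>\<close> is the increment.\<close>

lemma path_integral_eq_increment:
  assumes \<gamma>: "pathin (pts R) \<gamma>" and q: "\<And>t. t \<in> {0..1} \<Longrightarrow> \<gamma> t \<noteq> q"
  shows "path_integral R \<Omega> \<gamma> = increment \<gamma> + pole_part (\<gamma> 1) - pole_part (\<gamma> 0)"
    and "\<exists>F. primitive_along R {0..1} \<Omega> \<gamma> F"
proof -
  obtain F where F: "continuation regular {0..1} \<gamma> F"
    using continuation_exists[OF \<gamma> cover] by blast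
  have *: "primitive_along R {0..1} \<Omega> \<gamma> (\<lambda>t. F t + pole_part (\<gamma> t))"
    using primitive_along_of_continuation[OF F q] .
  then show "\<exists>F. primitive_along R {0..1} \<Omega> \<gamma> F" by blast
  show "path_integral R \<Omega> \<gamma> = increment \<gamma> + pole_part (\<gamma> 1) - pole_part (\<gamma> 0)"
    using path_integral_eq[OF R \<gamma> *] increment_eq[OF \<gamma> F] by simp
qed

text \<open>For a path that starts at the pole, the regularization \<open>u + o(1)\<close> means exactly that the
integral of the regularized class starts at 0 there.\<close>

lemma reg_path_integral_eq_increment:
  assumes \<gamma>: "pathin (pts R) \<gamma>" "\<gamma> 0 = q" and q: "\<And>t. t \<in> {0<..1} \<Longrightarrow> \<gamma> t \<noteq> q"
  shows "reg_path_integral R u \<Omega> \<gamma> = increment \<gamma> + pole_part (\<gamma> 1)"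
proof -
  have c: "continuous_map (top_of_set {0..1}) (pts R) \<gamma>" using \<gamma> by (simp add: pathin_def)
  have near: "\<forall>\<^sub>F t in at_right 0. \<gamma> t \<in> W" if W: "openin (pts R) W" "q \<in> W" for W
  proof -
    obtain d where d: "0 < d" "\<And>s. s \<in> {0..1} \<Longrightarrow> dist s 0 < d \<Longrightarrow> \<gamma> s \<in> W"
      using continuous_map_near_real[OF c W(1), of 0] \<gamma>(2) W(2) by auto
    show ?thesis unfolding eventually_at_right_field
      by (intro exI[of _ "min d 1"]) (use d in \<open>auto simp: dist_real_def\<close>)
  qed
  obtain F where F: "continuation regular {0..1} \<gamma> F"
    using continuation_exists[OF \<gamma>(1) cover] by blast
  define H where "H = (\<lambda>t. (F t - F 0) + pole_part (\<gamma> t))"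
  have "continuation regular {0<..1} \<gamma> F" by (rule continuation_subset[OF F]) auto
  from continuation_add_const[OF this, of "- F 0"]
  have "continuation regular {0<..1} \<gamma> (\<lambda>t. F t - F 0)" by simp
  then have H: "primitive_along R {0<..1} \<Omega> \<gamma> H"
    unfolding H_def using q by (rule primitive_along_of_continuation)
  have lim: "((\<lambda>t. H t - u (\<gamma> t)) \<longlongrightarrow> 0) (at_right 0)"
  proof (rule tendstoI)
    fix e :: real assume e: "0 < e"
    obtain V G d where V: "regular V G" "0 < d"
      and d: "\<forall>s\<in>{0..1}. \<bar>s - 0\<bar> < d \<longrightarrow> \<gamma> s \<in> V \<and> F s = G (\<gamma> s)"
      using F unfolding continuation_def by (metis atLeastAtMost_iff order_refl zero_le_one)
    have 0: "q \<in> V" "F 0 = G q" using d V(2) \<gamma>(2) by auto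
    \<comment> \<open>As \<open>q \<in> V\<close>, the function \<open>G\<close> is a primitive of \<open>\<theta>\<close>, and therefore continuous at \<open>q\<close>.\<close>
    then have G: "primitive_on R V G \<theta>" using V(1) by (auto simp: regular_def)
    obtain W where W: "openin (pts R) W" "q \<in> W" "\<forall>p\<in>W. dist (G p) (G q) < e"
      using primitive_continuous[OF R G 0(1) e] by blast
    have "\<forall>\<^sub>F t in at_right 0. (0::real) < t \<and> t < min d 1"
      using V(2) by (auto simp: eventually_at_right_field intro!: exI[of _ "min d 1"])
    then show "\<forall>\<^sub>F t in at_right 0. dist (H t - u (\<gamma> t)) 0 < e"
      using near[OF W(1,2)] near[OF N]
    proof eventually_elim
      case (elim t)
      have "pole_part (\<gamma> t) = u (\<gamma> t)" using elim q[of t] by (simp add: pole_part_def)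
      moreover have "F t = G (\<gamma> t)" using elim d by auto
      ultimately show ?case using W(3) elim 0 by (simp add: H_def dist_norm)
    qed
  qed
  show ?thesis unfolding reg_path_integral_def
  proof (rule the_equality)
    have "increment \<gamma> + pole_part (\<gamma> 1) = H 1" using increment_eq[OF \<gamma>(1) F] by (simp add: H_def)
    then show "\<exists>F. primitive_along R {0<..1} \<Omega> \<gamma> F \<and> ((\<lambda>t. F t - u (\<gamma> t)) \<longlongrightarrow> 0) (at_right 0) \<and>
        increment \<gamma> + pole_part (\<gamma> 1) = F 1"
      using H lim by blast
    fix I assume "\<exists>F. primitive_along R {0<..1} \<Omega> \<gamma> F \<and>
        ((\<lambda>t. F t - u (\<gamma> t)) \<longlongrightarrow> 0) (at_right 0) \<and> I = F 1"
    then obtain F' where F': "primitive_along R {0<..1} \<Omega> \<gamma> F'" "I = F' 1"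
      and lim': "((\<lambda>t. F' t - u (\<gamma> t)) \<longlongrightarrow> 0) (at_right 0)" by blast
    have c': "continuous_map (top_of_set {0<..1}) (pts R) \<gamma>"
      by (rule continuous_map_from_subtopology_mono[OF c]) auto
    have const: "F' t - H t = F' 1 - H 1" if "t \<in> {0<..1}" for t
    proof -
      have 1: "(1::real) \<in> {0<..1}" by simp
      have con: "connected {0<..1::real}" by (intro convex_connected convex_real_interval)
      show ?thesis
        by (rule local_system.continuation_unique[OF local_system_primitives[OF R, of \<Omega>] con c'
            F'(1)[unfolded primitive_along_iff_continuation[OF R]]
            H[unfolded primitive_along_iff_continuation[OF R]] that 1])
    qed
    have "((\<lambda>t. (F' t - u (\<gamma> t)) - (H t - u (\<gamma> t))) \<longlongrightarrow> 0 - 0) (at_right 0)"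
      by (intro tendsto_diff lim lim')
    moreover have "\<forall>\<^sub>F t in at_right (0::real). (F' t - u (\<gamma> t)) - (H t - u (\<gamma> t)) = F' 1 - H 1"
    proof -
      have "(F' t - u (\<gamma> t)) - (H t - u (\<gamma> t)) = F' 1 - H 1" if "0 < t" "t < 1" for t
        using const[of t] that by simp
      then show ?thesis unfolding eventually_at_right_field using zero_less_one by blast
    qed
    ultimately have "((\<lambda>t::real. F' 1 - H 1) \<longlongrightarrow> 0) (at_right 0)"
      using tendsto_cong[of "\<lambda>t. (F' t - u (\<gamma> t)) - (H t - u (\<gamma> t))" "\<lambda>t. F' 1 - H 1"] by simp
    then have "F' 1 - H 1 = 0" by (simp add: tendsto_const_iff)
    then show "I = increment \<gamma> + pole_part (\<gamma> 1)"
      using F' \<open>increment \<gamma> + pole_part (\<gamma> 1) = H 1\<close> by simp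
  qed
qed

end

section \<open>Antiholomorphic involutions\<close>

text \<open>The chain rule, with \<open>cnj\<close> inserted twice to write the antiholomorphic composition as a composition
of holomorphic functions.\<close>

lemma conj_pullback_primitive:
  assumes R: "riemann_surface R" and \<tau>: "antiholomorphic_involution R \<tau>"
    and \<Omega>: "diff_eq R (conj_pullback R \<tau> \<Omega>) \<Omega>'" and G: "primitive_on R V G \<Omega>"
  shows "primitive_on R {p \<in> topspace (pts R). \<tau> p \<in> V} (\<lambda>p. cnj (G (\<tau> p))) \<Omega>'"
  unfolding primitive_on_def
proof (intro conjI ballI)
  have cont: "continuous_map (pts R) (pts R) \<tau>" using \<tau> by (simp add: antiholomorphic_involution_def)
  have V: "openin (pts R) V" using G by (simp add: primitive_on_def)
  show "openin (pts R) {p \<in> topspace (pts R). \<tau> p \<in> V}"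
    by (rule openin_continuous_map_preimage[OF cont V])
  fix \<kappa> p assume \<kappa>: "\<kappa> \<in> atlas R" and p: "p \<in> {p \<in> topspace (pts R). \<tau> p \<in> V} \<inter> fst \<kappa>"
  define \<kappa>' where "\<kappa>' = chart_at R (\<tau> p)"
  have "\<tau> p \<in> topspace (pts R)" using p openin_subset[OF V] by blast
  then have \<kappa>': "\<kappa>' \<in> atlas R" "\<tau> p \<in> fst \<kappa>'" using chart_at[OF R] by (auto simp: \<kappa>'_def)
  define S where "S = {p \<in> topspace (pts R). \<tau> p \<in> fst \<kappa>'}"
  have S: "openin (pts R) S"
    unfolding S_def by (rule openin_continuous_map_preimage[OF cont chart_open[OF R \<kappa>'(1)]])
  have pS: "p \<in> S" using p \<kappa>' by (simp add: S_def)
  have eq: "{p \<in> fst \<kappa>. \<tau> p \<in> fst \<kappa>'} = fst \<kappa> \<inter> S"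
    using openin_subset[OF chart_open[OF R \<kappa>]] by (auto simp: S_def)
  define t where "t = cnj \<circ> snd \<kappa>' \<circ> \<tau> \<circ> chart_inv \<kappa>"
  have "t holomorphic_on (snd \<kappa> ` {p \<in> fst \<kappa>. \<tau> p \<in> fst \<kappa>'})"
    using \<tau> \<kappa> \<kappa>'(1) unfolding antiholomorphic_involution_def t_def by blast
  then have "t holomorphic_on (snd \<kappa> ` (fst \<kappa> \<inter> S))" by (simp only: eq)
  then have t: "(t has_field_derivative deriv t (snd \<kappa> p)) (at (snd \<kappa> p))"
    by (rule holomorphic_derivI[OF _ chart_image_open[OF R \<kappa> S]]) (use p pS in auto)
  have tp: "t (snd \<kappa> p) = cnj (snd \<kappa>' (\<tau> p))" using chart_inv_left[OF R \<kappa>] p by (simp add: t_def)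
  have G\<tau>: "((G \<circ> chart_inv \<kappa>') has_field_derivative \<Omega> \<kappa>' (\<tau> p)) (at (cnj (t (snd \<kappa> p))))"
    using G \<kappa>' p by (auto simp: primitive_on_def tp)
  have pulled_back: "\<Omega>' \<kappa> p = cnj (\<Omega> \<kappa>' (\<tau> p)) * deriv t (snd \<kappa> p)"
    using \<Omega> \<kappa> p unfolding diff_eq_def conj_pullback_def Let_def \<kappa>'_def t_def by auto
  from DERIV_chain[OF has_field_derivative_cnj_cnj[OF G\<tau>] t]
  have "((cnj \<circ> (G \<circ> chart_inv \<kappa>') \<circ> cnj \<circ> t) has_field_derivative \<Omega>' \<kappa> p) (at (snd \<kappa> p))"
    unfolding pulled_back .
  moreover have "cnj \<circ> (G \<circ> chart_inv \<kappa>') \<circ> cnj \<circ> t =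
      (\<lambda>r. cnj (G (chart_inv \<kappa>' (snd \<kappa>' (\<tau> r))))) \<circ> chart_inv \<kappa>"
    by (auto simp: t_def)
  ultimately have "(((\<lambda>r. cnj (G (chart_inv \<kappa>' (snd \<kappa>' (\<tau> r))))) \<circ> chart_inv \<kappa>)
      has_field_derivative \<Omega>' \<kappa> p) (at (snd \<kappa> p))" by simp
  then show "(((\<lambda>p. cnj (G (\<tau> p))) \<circ> chart_inv \<kappa>) has_field_derivative \<Omega>' \<kappa> p) (at (snd \<kappa> p))"
    by (rule has_derivative_in_chart_cong[OF R \<kappa> S pS, rotated 1])
      (use p chart_inv_left[OF R \<kappa>'(1)] in \<open>auto simp: S_def\<close>)
qed

text \<open>If \<open>\<Omega>'\<close> is the conjugate of \<open>\<tau>\<^sup>*\<Omega>\<close>, then integrating \<open>\<Omega>'\<close> along \<open>\<gamma>\<close> is conjugate to integrating \<open>\<Omega>\<close> along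
\<open>\<tau> \<circ> \<gamma>\<close>. A primitive of \<open>\<Omega>\<close> along \<open>\<tau> \<circ> \<gamma>\<close> is assumed to exist because \<open>path_integral\<close> is a
definite description.\<close>

lemma conj_pullback_path_integral:
  assumes R: "riemann_surface R" and \<tau>: "antiholomorphic_involution R \<tau>"
    and \<Omega>: "diff_eq R (conj_pullback R \<tau> \<Omega>) \<Omega>'" and \<gamma>: "pathin (pts R) \<gamma>"
    and F: "primitive_along R {0..1} \<Omega> (\<tau> \<circ> \<gamma>) F"
  shows "path_integral R \<Omega>' \<gamma> = cnj (path_integral R \<Omega> (\<tau> \<circ> \<gamma>))"
proof -
  have \<tau>\<gamma>: "pathin (pts R) (\<tau> \<circ> \<gamma>)"
    using \<gamma> \<tau> by (auto simp: antiholomorphic_involution_def pathin_compose)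
  have "primitive_along R {0..1} \<Omega>' \<gamma> (\<lambda>t. cnj (F t))"
    unfolding primitive_along_def
  proof
    fix t :: real assume "t \<in> {0..1}"
    then obtain V G d where V: "primitive_on R V G \<Omega>" "0 < d"
      and d: "\<forall>s\<in>{0..1}. \<bar>s - t\<bar> < d \<longrightarrow> (\<tau> \<circ> \<gamma>) s \<in> V \<and> F s = G ((\<tau> \<circ> \<gamma>) s)"
      using F unfolding primitive_along_def by metis
    have "\<gamma> s \<in> topspace (pts R)" if "s \<in> {0..1}" for s
      using \<gamma> that by (auto simp: pathin_def continuous_map_def)
    then have "\<forall>s\<in>{0..1}. \<bar>s - t\<bar> < d \<longrightarrow>
        \<gamma> s \<in> {p \<in> topspace (pts R). \<tau> p \<in> V} \<and> cnj (F s) = (\<lambda>p. cnj (G (\<tau> p))) (\<gamma> s)"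
      using d by auto
    with V(2) conj_pullback_primitive[OF R \<tau> \<Omega> V(1)]
    show "\<exists>V G d. primitive_on R V G \<Omega>' \<and> 0 < d \<and>
        (\<forall>s\<in>{0..1}. \<bar>s - t\<bar> < d \<longrightarrow> \<gamma> s \<in> V \<and> cnj (F s) = G (\<gamma> s))" by blast
  qed
  from path_integral_eq[OF R \<gamma> this] path_integral_eq[OF R \<tau>\<gamma> F] show ?thesis by simp
qed

text \<open>Here \<open>\<tau>\<close> acts on homology as \<open>-1\<close> on the span of the \<open>A i\<close> and as \<open>+1\<close> on the quotient spanned by the
\<open>B i\<close>. Hence, written in the basis, the relation \<open>c + \<tau> c = 0\<close> has twice the \<open>B\<close>-coefficients of
\<open>c\<close>, and by linear independence these are zero.\<close>

lemma anti_invariant_cycle: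
  fixes A B :: "nat \<Rightarrow> 'a chain" and h :: nat
  assumes basis: "\<And>c. singular_relcycle 1 X {} c \<Longrightarrow>
      \<exists>m n. homologous_rel 1 X {} c (\<Sum>i=1..h. frag_cmul (m i) (A i) + frag_cmul (n i) (B i))"
    and indep: "\<And>m n i. homologous_rel 1 X {} (\<Sum>i=1..h. frag_cmul (m i) (A i) + frag_cmul (n i) (B i)) 0 \<Longrightarrow>
      i \<in> {1..h} \<Longrightarrow> n i = 0"
    and \<tau>: "continuous_map X X \<tau>"
    and A: "\<And>i. i \<in> {1..h} \<Longrightarrow> homologous_rel 1 X {} (chain_map 1 \<tau> (A i)) (- A i)"
    and B: "\<And>i. i \<in> {1..h} \<Longrightarrow> homologous_rel 1 X {} (chain_map 1 \<tau> (B i))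
      (B i + (\<Sum>j=1..h. frag_cmul (k i j) (A j)))"
    and c: "singular_relcycle 1 X {} c" "chain_map 1 \<tau> c = - c"
  shows "\<exists>m. homologous_rel 1 X {} c (\<Sum>i=1..h. frag_cmul (m i) (A i))"
proof -
  let ?hom = "homologous_rel 1 X {}"
  obtain m n where mn: "?hom c (\<Sum>i=1..h. frag_cmul (m i) (A i) + frag_cmul (n i) (B i))"
    using basis[OF c(1)] by blast
  have cmul: "?hom (frag_cmul l a) (frag_cmul l b)" if "?hom a b" for l a b
  proof -
    have "frag_cmul l (a - b) = frag_cmul l a - frag_cmul l b"
      by (rule poly_mapping_eqI) (simp add: lookup_minus right_diff_distrib)
    then show ?thesis
      using that singular_relboundary_cmul[of 1 X "{}" "a - b" l] by (simp add: homologous_rel_def)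
  qed
  have sum: "?hom (\<Sum>i=1..h. a i) (\<Sum>i=1..h. b i)" if "\<And>i. i \<in> {1..h} \<Longrightarrow> ?hom (a i) (b i)" for a b
    by (rule homologous_rel_sum[OF finite_subset[of _ "{1..h}"] finite_subset[of _ "{1..h}"]])
      (use that in auto)
  have "?hom (chain_map 1 \<tau> c)
      (chain_map 1 \<tau> (\<Sum>i=1..h. frag_cmul (m i) (A i) + frag_cmul (n i) (B i)))"
    using mn singular_relboundary_chain_map[OF _ \<tau>, of 1 "{}" _ "{}"]
    by (simp add: homologous_rel_def flip: chain_map_diff)
  also have "chain_map 1 \<tau> (\<Sum>i=1..h. frag_cmul (m i) (A i) + frag_cmul (n i) (B i)) =
      (\<Sum>i=1..h. frag_cmul (m i) (chain_map 1 \<tau> (A i)) + frag_cmul (n i) (chain_map 1 \<tau> (B i)))"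
    by (simp add: chain_map_sum chain_map_add o_def)
  finally have 1: "?hom (- c) \<dots>" using c(2) by simp
  have 2: "?hom (\<Sum>i=1..h. frag_cmul (m i) (chain_map 1 \<tau> (A i)) + frag_cmul (n i) (chain_map 1 \<tau> (B i)))
      (\<Sum>i=1..h. frag_cmul (m i) (- A i) + frag_cmul (n i) (B i + (\<Sum>j=1..h. frag_cmul (k i j) (A j))))"
    using A B by (intro sum homologous_rel_add cmul)
  have "?hom (c + - c) ((\<Sum>i=1..h. frag_cmul (m i) (A i) + frag_cmul (n i) (B i)) +
      (\<Sum>i=1..h. frag_cmul (m i) (- A i) + frag_cmul (n i) (B i + (\<Sum>j=1..h. frag_cmul (k i j) (A j)))))"
    by (rule homologous_rel_add[OF mn homologous_rel_trans[OF 2 1]])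
  also have "\<dots> = (\<Sum>i=1..h. frag_cmul (2 * n i) (B i) + (\<Sum>j=1..h. frag_cmul (n i * k i j) (A j)))"
    unfolding sum.distrib[symmetric]
    by (intro sum.cong refl poly_mapping_eqI)
      (simp add: lookup_add lookup_sum sum_distrib_left algebra_simps)
  also have "\<dots> = (\<Sum>i=1..h. frag_cmul (2 * n i) (B i)) +
      (\<Sum>j=1..h. \<Sum>i=1..h. frag_cmul (n i * k i j) (A j))"
    unfolding sum.distrib by (intro arg_cong2[where f = "(+)"] refl sum.swap)
  also have "\<dots> = (\<Sum>i=1..h. frag_cmul (\<Sum>l=1..h. n l * k l i) (A i) + frag_cmul (2 * n i) (B i))"
  proof -
    have "(\<Sum>i=1..h. frag_cmul (n i * k i j) (A j)) = frag_cmul (\<Sum>i=1..h. n i * k i j) (A j)" for j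
      by (rule poly_mapping_eqI) (simp add: lookup_sum sum_distrib_right)
    then show ?thesis by (simp add: sum.distrib add.commute)
  qed
  finally have "?hom (\<Sum>i=1..h. frag_cmul (\<Sum>l=1..h. n l * k l i) (A i) + frag_cmul (2 * n i) (B i)) 0"
    by (simp add: homologous_rel_sym)
  then have "n i = 0" if "i \<in> {1..h}" for i
    using indep[of "\<lambda>i. \<Sum>l=1..h. n l * k l i" "\<lambda>i. 2 * n i" i] that by simp
  then have "(\<Sum>i=1..h. frag_cmul (m i) (A i) + frag_cmul (n i) (B i)) = (\<Sum>i=1..h. frag_cmul (m i) (A i))"
    by (intro sum.cong) auto
  then show ?thesis using mn by auto
qed

lemma path_chain_cong:
  assumes "\<And>t. t \<in> {0..1} \<Longrightarrow> \<gamma> t = \<delta> t"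
  shows "path_chain \<gamma> = path_chain \<delta>"
proof -
  have "restrict (\<lambda>x. \<gamma> (x 1)) (standard_simplex 1) = restrict (\<lambda>x. \<delta> (x 1)) (standard_simplex 1)"
    by (rule restrict_ext) (auto simp: standard_simplex_def intro: assms)
  then show ?thesis by (simp only: path_chain_def)
qed

text \<open>The paths start at the same point and \<open>\<tau>\<close> fixes their endpoints, so the chain
\<open>c = \<gamma> - \<tau>\<gamma> - (\<delta> - \<tau>\<delta>)\<close> is a cycle with \<open>\<tau> c = - c\<close>. Such cycles are combinations of the \<open>A i\<close>, whose
increments vanish.\<close>

lemma (in covering_local_system) antisymmetric_increment:
  fixes A :: "nat \<Rightarrow> 'a chain" and h :: nat
  assumes \<tau>: "continuous_map X X \<tau>" "\<And>p. p \<in> topspace X \<Longrightarrow> \<tau> (\<tau> p) = p"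
    and span: "\<And>c. singular_relcycle 1 X {} c \<Longrightarrow> chain_map 1 \<tau> c = - c \<Longrightarrow>
      \<exists>m. homologous_rel 1 X {} c (\<Sum>i=1..h. frag_cmul (m i) (A i))"
    and A: "\<And>i. i \<in> {1..h} \<Longrightarrow> chain_increment (A i) = 0"
    and \<gamma>: "pathin X \<gamma>" "\<tau> (\<gamma> 1) = \<gamma> 1" and \<delta>: "pathin X \<delta>" "\<tau> (\<delta> 1) = \<delta> 1" and start: "\<gamma> 0 = \<delta> 0"
  shows "increment \<gamma> - increment (\<tau> \<circ> \<gamma>) = increment \<delta> - increment (\<tau> \<circ> \<delta>)"
proof -
  define c where "c = path_chain \<gamma> - path_chain (\<tau> \<circ> \<gamma>) - (path_chain \<delta> - path_chain (\<tau> \<circ> \<delta>))"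
  have \<tau>\<gamma>: "pathin X (\<tau> \<circ> \<gamma>)" and \<tau>\<delta>: "pathin X (\<tau> \<circ> \<delta>)"
    using pathin_compose[OF \<gamma>(1) \<tau>(1)] pathin_compose[OF \<delta>(1) \<tau>(1)] .
  have chain: "singular_chain 1 X c"
    unfolding c_def by (intro singular_chain_diff singular_chain_path \<gamma> \<delta> \<tau>\<gamma> \<tau>\<delta>)
  have "chain_boundary 1 c = 0"
    unfolding c_def chain_boundary_diff chain_boundary_path using \<gamma>(2) \<delta>(2) start by simp
  with chain have cycle: "singular_relcycle 1 X {} c" unfolding singular_cycle by blast
  have twice: "path_chain (\<tau> \<circ> (\<tau> \<circ> \<epsilon>)) = path_chain \<epsilon>" if "pathin X \<epsilon>" for \<epsilon>
  proof (rule path_chain_cong)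
    fix t :: real assume "t \<in> {0..1}"
    then have "\<epsilon> t \<in> topspace X" using that by (auto simp: pathin_def continuous_map_def)
    then show "(\<tau> \<circ> (\<tau> \<circ> \<epsilon>)) t = \<epsilon> t" using \<tau>(2) by simp
  qed
  have "chain_map 1 \<tau> c = - c"
    unfolding c_def chain_map_diff chain_map_path twice[OF \<gamma>(1)] twice[OF \<delta>(1)] by simp
  then obtain m where "homologous_rel 1 X {} c (\<Sum>i=1..h. frag_cmul (m i) (A i))"
    using span[OF cycle] by blast
  then have "chain_increment c = 0"
    using chain_increment_homologous A by (simp add: chain_increment_sum chain_increment_cmul)
  then show ?thesis
    by (simp add: c_def chain_increment_diff chain_increment_path)
qed

lemma indicator_combination:
  assumes "finite I" "K \<subseteq> I" "i \<in> I"
  shows "(\<Sum>j\<in>I. frag_cmul ((if j \<in> K then 1 else 0) - (if j = i then 1 else 0)) (A j)) = (\<Sum>j\<in>K. A j) - A i"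
proof -
  have "(\<Sum>j\<in>I. frag_cmul (if j \<in> K then 1 else 0) (A j)) = (\<Sum>j\<in>K. A j)"
    using assms(1,2) by (intro sum.mono_neutral_cong_right) auto
  moreover have "(\<Sum>j\<in>I. frag_cmul (if j = i then 1 else 0) (A j)) = A i"
    using sum.mono_neutral_cong_right[OF assms(1), of "{i}" "\<lambda>j. frag_cmul (if j = i then 1 else 0) (A j)" A] assms(3)
    by auto
  ultimately show ?thesis by (simp only: frag_cmul_diff_distrib sum_subtractf)
qed

section \<open>Isolated points and poles\<close>

text \<open>Guarantees that a limit at a point of the surface is not vacuous.\<close>

lemma point_not_isolated:
  assumes R: "riemann_surface R" and q: "q \<in> topspace (pts R)"
  shows "atin (pts R) q \<noteq> bot"
proof
  assume "atin (pts R) q = bot"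
  then have "eventually (\<lambda>_. False) (atin (pts R) q)" by simp
  then obtain T where T: "openin (pts R) T" "q \<in> T" "T \<subseteq> {q}"
    using q unfolding eventually_atin by blast
  obtain \<kappa> where \<kappa>: "\<kappa> \<in> atlas R" "q \<in> fst \<kappa>" using chart_exists[OF R q] by blast
  obtain r where r: "0 < r" "ball (snd \<kappa> q) r \<subseteq> snd \<kappa> ` (fst \<kappa> \<inter> T)"
    using chart_disc[OF R \<kappa>(1) T(1,2) \<kappa>(2)] by blast
  have "snd \<kappa> q + of_real (r / 2) \<in> ball (snd \<kappa> q) r" using r(1) by (simp add: dist_norm)
  then have "snd \<kappa> q + of_real (r / 2) = snd \<kappa> q" using r(2) T(3) by blast
  then show False using r(1) by simp
qed

text \<open>A negative order forces a pole, where meromorphic functions take the value 0 by convention.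
The last assumption excludes that \<open>F\<close> vanishes identically near \<open>p\<close>, where \<open>zorder\<close> carries no
information.\<close>

lemma meromorphic_fun_pole_value:
  assumes R: "riemann_surface R" and F: "meromorphic_fun R F" and p: "p \<in> topspace (pts R)"
    and order: "fun_order R F p < 0"
    and V: "openin (pts R) V" "p \<in> V" "\<And>q. q \<in> V - {p} \<Longrightarrow> F q \<noteq> 0"
  shows "F p = 0"
proof -
  define \<kappa> where "\<kappa> = chart_at R p"
  have \<kappa>: "\<kappa> \<in> atlas R" "p \<in> fst \<kappa>" using chart_at[OF R p] by (auto simp: \<kappa>_def)
  let ?f = "F \<circ> chart_inv \<kappa>" and ?z = "snd \<kappa> p"
  have f: "?f nicely_meromorphic_on (snd \<kappa> ` fst \<kappa>)" "?z \<in> snd \<kappa> ` fst \<kappa>"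
    using F \<kappa> by (auto simp: meromorphic_fun_def)
  obtain r where r: "0 < r" "ball ?z r \<subseteq> snd \<kappa> ` (fst \<kappa> \<inter> V)"
    using chart_disc[OF R \<kappa>(1) V(1,2) \<kappa>(2)] by blast
  have "?f w \<noteq> 0" if w: "w \<noteq> ?z" "dist w ?z < r" for w
  proof -
    have "w \<in> ball ?z r" using w(2) by (simp add: dist_commute)
    then obtain q where q: "q \<in> fst \<kappa>" "q \<in> V" "w = snd \<kappa> q" using r(2) by blast
    then have "q \<noteq> p" using w(1) by blast
    then show ?thesis using V(3)[of q] q chart_inv_left[OF R \<kappa>(1) q(1)] by simp
  qed
  then have "\<forall>\<^sub>F w in at ?z. ?f w \<noteq> 0" unfolding eventually_at using r(1) by blast
  then have nz: "\<exists>\<^sub>F w in at ?z. ?f w \<noteq> 0" by (rule eventually_frequently[rotated]) simp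
  have "is_pole ?f ?z"
  proof (rule ccontr)
    assume "\<not> is_pole ?f ?z"
    then have "0 \<le> zorder ?f ?z"
      by (intro zorder_ge_0 nicely_meromorphic_on_imp_analytic_at[OF f] nz)
    then show False using order by (simp add: fun_order_def Let_def \<kappa>_def)
  qed
  then have "?f ?z = 0" using f is_pole_def not_tendsto_and_filterlim_at_infinity[of "at ?z" ?f]
    unfolding nicely_meromorphic_on_def by (metis at_neq_bot)
  then show ?thesis using chart_inv_left[OF R \<kappa>] by simp
qed

section \<open>Theta functions and projective points\<close>

text \<open>The shift leaves every single term of the theta series unchanged.\<close>

lemma prym_theta_periodic:
  assumes "\<And>j. j \<in> {1..g} \<Longrightarrow> \<exists>n::int. w' j = w j + 2 * complex_of_real pi * \<i> * of_int n"
  shows "prym_theta g Per w' = prym_theta g Per w"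
proof -
  obtain n :: "nat \<Rightarrow> int" where n: "\<And>j. j \<in> {1..g} \<Longrightarrow> w' j = w j + 2 * complex_of_real pi * \<i> * of_int (n j)"
    using assms by metis
  show ?thesis
    unfolding prym_theta_def
  proof (rule infsum_cong)
    fix N :: "nat \<Rightarrow> int"
    have "(\<Sum>k=1..g. w' k * of_int (N k)) = (\<Sum>k=1..g. w k * of_int (N k) + 2 * complex_of_real pi * \<i> * of_int (n k * N k))"
      by (rule sum.cong) (simp_all add: n algebra_simps)
    also have "\<dots> = (\<Sum>k=1..g. w k * of_int (N k)) + 2 * complex_of_real pi * \<i> * of_int (\<Sum>k=1..g. n k * N k)"
      by (simp add: sum.distrib sum_distrib_left)
    finally show "exp ((\<Sum>k=1..g. \<Sum>j=1..g. Per k j * of_int (N j) * of_int (N k)) / 2 + (\<Sum>k=1..g. w' k * of_int (N k))) =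
        exp ((\<Sum>k=1..g. \<Sum>j=1..g. Per k j * of_int (N j) * of_int (N k)) / 2 + (\<Sum>k=1..g. w k * of_int (N k)))"
      unfolding exp_eq by (intro exI[of _ "\<Sum>k=1..g. n k * N k"]) (simp add: algebra_simps)
  qed
qed

lemma proj_point_scale:
  assumes "c \<noteq> 0"
  shows "proj_point (c *s v) = proj_point v"
proof -
  have "range (\<lambda>d. d *s (c *s v)) = range (\<lambda>d. d *s v)"
  proof (intro equalityI subsetI)
    fix y assume "y \<in> range (\<lambda>d. d *s v)"
    then obtain d where "y = d *s v" by blast
    then have "y = (d / c) *s (c *s v)" using assms by (simp add: vector_smult_assoc)
    then show "y \<in> range (\<lambda>d. d *s (c *s v))" by blast
  qed (auto simp: vector_smult_assoc)
  then show ?thesis by (simp add: proj_point_def)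
qed

section \<open>Double periodicity\<close>

theorem theorem6p4:
  fixes R :: "'a surface" and g :: nat
    and P0 Pinf :: 'a and lam :: "'a \<Rightarrow> complex" and \<sigma> \<tau> :: "'a \<Rightarrow> 'a"
    and a b :: "nat \<Rightarrow> real \<Rightarrow> 'a" and \<omega> :: "nat \<Rightarrow> 'a differential"
    and Per :: "nat \<Rightarrow> nat \<Rightarrow> complex" and \<eta> :: "(nat \<Rightarrow> complex) \<Rightarrow> complex"
    and \<nu> \<rho> :: "'a \<Rightarrow> complex" and \<Omega>inf \<Omega>0 :: "'a differential" and U V :: "nat \<Rightarrow> complex"
    and D :: "'a \<Rightarrow> nat" and e :: "nat \<Rightarrow> complex" and \<alpha> :: "'a differential"
    and pth :: "'a \<Rightarrow> real \<Rightarrow> 'a" and f :: "complex \<Rightarrow> complex"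
    and \<psi> :: "complex \<Rightarrow> 'a \<Rightarrow> complex" and W :: "'a \<Rightarrow> complex"
    and P :: "3 \<Rightarrow> 'a" and x :: "complex \<Rightarrow> cp2" and Z1 Z2 :: complex
  \<comment> \<open>the spectral curve\<close>
  assumes g: "g mod 6 = 1"
    and surface: "compact_riemann_surface R" "has_genus R (2 * g)"
    and points: "P0 \<in> topspace (pts R)" "Pinf \<in> topspace (pts R)" "P0 \<noteq> Pinf"
    and lam: "meromorphic_fun R lam"
      "\<forall>p\<in>topspace (pts R). fun_order R lam p = 3 * pt P0 p - 3 * pt Pinf p"
    and \<sigma>: "holomorphic_involution R \<sigma>"
      "\<forall>p\<in>topspace (pts R). lam (\<sigma> p) = - lam p"
    and \<tau>: "antiholomorphic_involution R \<tau>" "separating_type R \<tau>"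
      "\<forall>p\<in>topspace (pts R) - {P0, Pinf}. lam (\<tau> p) * cnj (lam p) = 1"
    and regions: "P0 \<notin> ovals R \<tau>" "Pinf \<notin> ovals R \<tau>"
      "topspace (pts R) - ovals R \<tau> = region R \<tau> P0 \<union> region R \<tau> Pinf"
      "region R \<tau> P0 \<inter> region R \<tau> Pinf = {}"
    and branch: "\<forall>p\<in>topspace (pts R) - {P0, Pinf}. d_fun lam (chart_at R p) p = 0 \<longrightarrow>
      cmod (lam p) \<noteq> 1 \<and>
      (\<exists>q\<in>topspace (pts R) - {P0, Pinf}. d_fun lam (chart_at R q) q = 0 \<and> lam q = - lam p) \<and>
      (\<exists>q\<in>topspace (pts R) - {P0, Pinf}. d_fun lam (chart_at R q) q = 0 \<and> lam q = 1 / cnj (lam p))"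
  \<comment> \<open>homology and theta functions\<close>
    and basis: "canonical_basis R (2 * g) a b"
      "\<forall>i\<in>{1..2 * g}. \<forall>t\<in>{0..1}. a i t \<notin> {P0, Pinf} \<and> b i t \<notin> {P0, Pinf}"
    and \<sigma>_basis: "\<forall>i\<in>{1..g}.
      homologous R (path_chain (\<sigma> \<circ> a i)) (- path_chain (a (i + g))) \<and>
      homologous R (path_chain (\<sigma> \<circ> b i)) (- path_chain (b (i + g)))"
    and \<tau>_basis: "\<forall>i\<in>{1..g}.
      homologous R (path_chain (\<tau> \<circ> a i)) (- path_chain (a i)) \<and>
      homologous R (path_chain (\<tau> \<circ> b i))
        (path_chain (b i) - path_chain (a i) + (\<Sum>k=1..g. path_chain (a k))) \<and>
      homologous R (path_chain (\<tau> \<circ> a (i + g))) (- path_chain (a (i + g))) \<and>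
      homologous R (path_chain (\<tau> \<circ> b (i + g)))
        (path_chain (b (i + g)) - path_chain (a (i + g)) + (\<Sum>k=1..g. path_chain (a (k + g))))"
    and \<omega>: "\<forall>j\<in>{1..2 * g}. holomorphic_diff_on R (topspace (pts R)) (\<omega> j)"
      "\<forall>i\<in>{1..2 * g}. \<forall>j\<in>{1..2 * g}.
         path_integral R (\<omega> j) (a i) = (if i = j then 2 * complex_of_real pi * \<i> else 0)"
    and Per: "Per = (\<lambda>k j. path_integral R (prym_diff g \<omega> j) (b k))"
    and \<eta>: "\<eta> = prym_theta g Per"
  \<comment> \<open>local parameters and differentials of the second kind\<close>
    and \<nu>: "local_parameter R (\<lambda>p. inverse (\<nu> p)) Pinf"
      "\<exists>N. openin (pts R) N \<and> Pinf \<in> N \<and> (\<forall>p\<in>N. \<nu> p ^ 3 = lam p \<and> \<nu> (\<sigma> p) = - \<nu> p)"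
    and \<rho>: "\<rho> = (\<lambda>p. cnj (\<nu> (\<tau> p)))"
      "local_parameter R (\<lambda>p. inverse (\<rho> p)) P0"
      "\<exists>N. openin (pts R) N \<and> P0 \<in> N \<and> (\<forall>p\<in>N. \<rho> (\<sigma> p) = - \<rho> p)"
    and \<Omega>_pole: "second_kind R \<Omega>inf \<nu> Pinf" "second_kind R \<Omega>0 \<rho> P0"
    and \<Omega>_periods: "\<forall>i\<in>{1..2 * g}. path_integral R \<Omega>inf (a i) = 0 \<and> path_integral R \<Omega>0 (a i) = 0"
    and \<Omega>_\<sigma>: "diff_eq R (pullback R \<sigma> \<Omega>inf) (\<lambda>\<kappa> p. - \<Omega>inf \<kappa> p)"
      "diff_eq R (pullback R \<sigma> \<Omega>0) (\<lambda>\<kappa> p. - \<Omega>0 \<kappa> p)"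
    and \<Omega>_\<tau>: "diff_eq R (conj_pullback R \<tau> \<Omega>inf) \<Omega>0"
    and U: "U = (\<lambda>i. path_integral R \<Omega>inf (b i))"
    and V: "V = (\<lambda>i. path_integral R \<Omega>0 (b i))"
  \<comment> \<open>the divisor \<open>D\<close>\<close>
    and D: "finite {p. D p \<noteq> 0}" "{p. D p \<noteq> 0} \<subseteq> topspace (pts R) - {P0, Pinf}"
      "(\<Sum>p\<in>{p. D p \<noteq> 0}. D p) = 2 * g" "nonspecial R D"
    and D_\<sigma>: "\<exists>K. canonical_divisor R K \<and>
      lin_equiv R (\<lambda>p. int (D p) + int (D (\<sigma> p))) (\<lambda>p. pt P0 p + pt Pinf p + K p)"
    and e: "prym_theta_zero_divisor R g \<omega> Pinf Per e D"
  \<comment> \<open>the divisor \<open>D\<close> is in \<open>T\<^sub>0\<close>\<close>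
    and D_\<tau>: "\<exists>K. canonical_divisor R K \<and>
      lin_equiv R (\<lambda>p. int (D p) + int (D (\<tau> p))) (\<lambda>p. pt P0 p + pt Pinf p + K p)"
    and \<alpha>: "meromorphic_diff R \<alpha>" "nonzero_diff R \<alpha>"
      "\<forall>p\<in>topspace (pts R).
         diff_order R \<alpha> p = int (D p) + int (D (\<tau> p)) - pt P0 p - pt Pinf p"
      "diff_residue R \<alpha> P0 = \<i>" "diff_residue R \<alpha> Pinf = - \<i>"
      "positive_on_boundary R (ovals R \<tau>) (region R \<tau> Pinf) \<alpha>"
  \<comment> \<open>the Baker--Akhiezer function, with an arbitrary choice of paths from \<open>Pinf\<close>\<close>
    and pth: "\<forall>p\<in>topspace (pts R) - {P0, Pinf}. pathin (pts R) (pth p) \<and>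
      pth p 0 = Pinf \<and> pth p 1 = p \<and> (\<forall>t\<in>{0<..1}. pth p t \<notin> {P0, Pinf})"
    and \<psi>: "\<forall>z. \<forall>p\<in>topspace (pts R) - {P0, Pinf}. \<psi> z p =
      f z * (\<eta> (\<lambda>j. prym_map R g \<omega> (pth p) j + \<i> * U j * z + \<i> * V j * cnj z - e j)
             / \<eta> (\<lambda>j. prym_map R g \<omega> (pth p) j - e j))
          * inverse (lam p)
          * exp (\<i> * z * reg_path_integral R \<nu> \<Omega>inf (pth p)
                 + \<i> * cnj z * path_integral R \<Omega>0 (pth p))"
    and f: "\<forall>z. ((\<lambda>p. \<psi> z p / (inverse (\<nu> p ^ 3) * exp (\<i> * \<nu> p * z))) \<longlongrightarrow> 1) (atin (pts R) Pinf)"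
    and W: "W = (\<lambda>p. \<i> * d_fun lam (chart_at R p) p / (lam p * \<alpha> (chart_at R p) p))"
  \<comment> \<open>the map into the complex projective plane\<close>
    and P: "inj P" "range P = {p \<in> topspace (pts R). lam p = 1}" "range P \<subseteq> ovals R \<tau>"
    and x: "x = (\<lambda>z. proj_point (\<chi> j. \<psi> z (P j) / csqrt (W (P j))))"
  \<comment> \<open>the periodicity conditions\<close>
    and Z: "Z1 \<noteq> Z2" "independent {Z1, Z2}"
    and ZU: "\<forall>Z\<in>{Z1, Z2}. \<forall>i\<in>{1..g}. \<exists>n :: int. Re (Z * U i) = pi * of_int n"
    and ZP: "\<forall>Z\<in>{Z1, Z2}. \<forall>j. \<exists>n :: int.
      Re (Z * reg_path_integral R \<nu> \<Omega>inf (pth (P j))) = pi * of_int n"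
  shows "\<forall>Z\<in>{Z1, Z2}. \<forall>z. x (z + Z) = x z"
proof -
  have R: "riemann_surface R" using surface by (simp add: compact_riemann_surface_def)
  have \<tau>c: "continuous_map (pts R) (pts R) \<tau>" and \<tau>\<tau>: "\<And>p. p \<in> topspace (pts R) \<Longrightarrow> \<tau> (\<tau> p) = p"
    using \<tau>(1) by (auto simp: antiholomorphic_involution_def)
  have \<tau>_path: "pathin (pts R) (\<tau> \<circ> \<gamma>)" if "pathin (pts R) \<gamma>" for \<gamma>
    using that \<tau>c by (rule pathin_compose)
  have path_top: "\<gamma> t \<in> topspace (pts R)" if "pathin (pts R) \<gamma>" "t \<in> {0..1}" for \<gamma> t
    using that by (auto simp: pathin_def continuous_map_def)
  \<comment> \<open>At its pole \<open>lam\<close> takes the value 0, whereas \<open>lam (\<tau> p)\<close> is nonzero for \<open>p\<close> other than \<open>P0\<close> and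
    \<open>Pinf\<close>. Hence only \<open>P0\<close> can be mapped to \<open>Pinf\<close> by \<open>\<tau>\<close>, and mirror images of paths that avoid \<open>P0\<close>
    avoid the pole of \<open>\<Omega>inf\<close>.\<close>
  have "lam Pinf = 0"
  proof (rule meromorphic_fun_pole_value[OF R lam(1) points(2)])
    show "fun_order R lam Pinf < 0" using lam(2) points by (simp add: pt_def)
    show "openin (pts R) (topspace (pts R) - {P0})" by (rule openin_delete_point[OF R openin_topspace])
    show "Pinf \<in> topspace (pts R) - {P0}" using points by simp
    show "lam p \<noteq> 0" if "p \<in> topspace (pts R) - {P0} - {Pinf}" for p
      using bspec[OF \<tau>(3), of p] that by auto
  qed
  then have \<tau>_Pinf: "\<tau> p \<noteq> Pinf" if "p \<in> topspace (pts R)" "p \<noteq> P0" for p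
    using that bspec[OF \<tau>(3), of p] regions(2) points(2) by (cases "p = Pinf") (auto simp: ovals_def)
  obtain N \<theta> where N: "openin (pts R) N" "Pinf \<in> N" "holomorphic_diff_on R N \<theta>"
    "primitive_on R (N - {Pinf}) \<nu> (\<lambda>\<kappa> p. \<Omega>inf \<kappa> p - \<theta> \<kappa> p)"
    using second_kind_local_form[OF R \<nu>(1) \<Omega>_pole(1) points(2)] by blast
  interpret pole_datum R \<Omega>inf \<nu> Pinf N \<theta>
    using R N \<Omega>_pole(1) by unfold_locales (auto simp: second_kind_def)
  have loops: "pathin (pts R) (a i)" "a i 0 = a i 1" "pathin (pts R) (b i)" "b i 0 = b i 1"
    if "i \<in> {1..2 * g}" for i
    using basis(1) that by (auto simp: canonical_basis_def loop_def)
  have avoid: "a i t \<noteq> Pinf" "b i t \<noteq> Pinf" "b i t \<noteq> P0" if "i \<in> {1..2 * g}" "t \<in> {0..1}" for i t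
    using basis(2) that by auto
  have a_increment: "chain_increment (path_chain (a i)) = 0" if i: "i \<in> {1..2 * g}" for i
    using path_integral_eq_increment(1)[OF loops(1)[OF i]] avoid(1)[OF i] \<Omega>_periods i loops(2)[OF i]
    by (simp add: chain_increment_path)
  have conj_integral: "path_integral R \<Omega>0 \<gamma> =
      cnj (increment (\<tau> \<circ> \<gamma>) + pole_part (\<tau> (\<gamma> 1)) - pole_part (\<tau> (\<gamma> 0)))"
    if \<gamma>: "pathin (pts R) \<gamma>" "\<And>t. t \<in> {0..1} \<Longrightarrow> \<gamma> t \<noteq> P0" for \<gamma>
  proof -
    have away: "(\<tau> \<circ> \<gamma>) t \<noteq> Pinf" if "t \<in> {0..1}" for t
      using \<tau>_Pinf[OF path_top[OF \<gamma>(1) that] \<gamma>(2)[OF that]] by simp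
    obtain F where "primitive_along R {0..1} \<Omega>inf (\<tau> \<circ> \<gamma>) F"
      using path_integral_eq_increment(2)[OF \<tau>_path[OF \<gamma>(1)] away] by blast
    from conj_pullback_path_integral[OF R \<tau>(1) \<Omega>_\<tau> \<gamma>(1) this]
    have "path_integral R \<Omega>0 \<gamma> = cnj (path_integral R \<Omega>inf (\<tau> \<circ> \<gamma>))" .
    also have "path_integral R \<Omega>inf (\<tau> \<circ> \<gamma>) =
        increment (\<tau> \<circ> \<gamma>) + pole_part ((\<tau> \<circ> \<gamma>) 1) - pole_part ((\<tau> \<circ> \<gamma>) 0)"
      by (rule path_integral_eq_increment(1)[OF \<tau>_path[OF \<gamma>(1)]]) (rule away)
    finally show ?thesis by (simp only: o_apply)
  qed

  \<comment> \<open>The class of \<open>\<tau> (b i)\<close> differs from that of \<open>b i\<close> by \<open>a\<close>-cycles, over which \<open>\<Omega>inf\<close> has no period.\<close>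
  have VU: "V i = cnj (U i)" if i: "i \<in> {1..g}" for i
  proof -
    have i2: "i \<in> {1..2 * g}" using i by simp
    have "chain_increment (path_chain (\<tau> \<circ> b i)) =
        chain_increment (path_chain (b i) - path_chain (a i) + (\<Sum>k=1..g. path_chain (a k)))"
      using \<tau>_basis i by (intro chain_increment_homologous) blast
    also have "\<dots> = increment (b i)"
      using a_increment[OF i2] a_increment
      by (simp add: chain_increment_add chain_increment_diff chain_increment_sum chain_increment_path)
    also have "\<dots> = U i"
      using path_integral_eq_increment(1)[OF loops(3)[OF i2]] avoid(2)[OF i2] loops(4)[OF i2]
      by (simp add: U)
    finally show ?thesis
      using conj_integral[OF loops(3)[OF i2]] avoid(3)[OF i2] loops(4)[OF i2]
      by (simp add: V chain_increment_path)
  qed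

  \<comment> \<open>The relations for \<open>\<tau> (b i)\<close> with \<open>i \<le> g\<close> and with \<open>i > g\<close> are merged into one: \<open>K i\<close> is the half of
    the index range that contains \<open>i\<close>.\<close>
  have span: "\<exists>m. homologous R c (\<Sum>i=1..2*g. frag_cmul (m i) (path_chain (a i)))"
    if c: "singular_relcycle 1 (pts R) {} c" "chain_map 1 \<tau> c = - c" for c
  proof -
    define K where "K i = (if i \<le> g then {1..g} else {1+g..g+g})" for i
    have half: "i \<in> {1..g} \<or> (\<exists>j\<in>{1..g}. i = j + g)" if "i \<in> {1..2 * g}" for i
      using that by (cases "i \<le> g") (auto intro!: bexI[of _ "i - g"])
    have \<tau>a: "homologous R (chain_map 1 \<tau> (path_chain (a i))) (- path_chain (a i))"
      if "i \<in> {1..2 * g}" for i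
      unfolding chain_map_path using half[OF that] \<tau>_basis by blast
    have shift: "(\<Sum>k=1..g. path_chain (a (k + g))) = (\<Sum>k=1+g..g+g. path_chain (a k))"
      by (rule sum.shift_bounds_cl_nat_ivl[symmetric])
    have \<tau>b: "homologous R (chain_map 1 \<tau> (path_chain (b i))) (path_chain (b i) +
        (\<Sum>j=1..2*g. frag_cmul ((if j \<in> K i then 1 else 0) - (if j = i then 1 else 0)) (path_chain (a j))))"
      if i: "i \<in> {1..2 * g}" for i
    proof -
      have hom: "homologous R (path_chain (\<tau> \<circ> b i))
          (path_chain (b i) - path_chain (a i) + (\<Sum>j\<in>K i. path_chain (a j)))"
        using half[OF i]
      proof
        assume "i \<in> {1..g}"
        then show ?thesis using \<tau>_basis by (auto simp: K_def)
      next
        assume "\<exists>j\<in>{1..g}. i = j + g"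
        then obtain j where j: "j \<in> {1..g}" "i = j + g" by blast
        then have "K i = {1+g..g+g}" by (simp add: K_def)
        then show ?thesis using \<tau>_basis j shift by metis
      qed
      have eq: "(\<Sum>j=1..2*g. frag_cmul ((if j \<in> K i then 1 else 0) - (if j = i then 1 else 0)) (path_chain (a j)))
          = (\<Sum>j\<in>K i. path_chain (a j)) - path_chain (a i)"
        by (rule indicator_combination) (use i in \<open>auto simp: K_def\<close>)
      show ?thesis
        unfolding chain_map_path eq using hom by (simp only: add_diff_eq diff_add_eq)
    qed
    have gen: "\<exists>m n. homologous R c (\<Sum>i=1..2*g. frag_cmul (m i) (path_chain (a i)) + frag_cmul (n i) (path_chain (b i)))"
      if "singular_relcycle 1 (pts R) {} c" for c
      using basis(1) that by (auto simp: canonical_basis_def homology_basis_def)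
    have indep: "n i = 0"
      if "homologous R (\<Sum>i=1..2*g. frag_cmul (m i) (path_chain (a i)) + frag_cmul (n i) (path_chain (b i))) 0"
        "i \<in> {1..2*g}" for m n i
      using basis(1) that unfolding canonical_basis_def homology_basis_def by blast
    show ?thesis
      by (rule anti_invariant_cycle[where B = "\<lambda>i. path_chain (b i)" and
            k = "\<lambda>i j. (if j \<in> K i then 1 else 0) - (if j = i then 1 else 0)" and
            A = "\<lambda>i. path_chain (a i)", OF _ _ \<tau>c _ _ c])
        (fact gen, fact indep, fact \<tau>a, fact \<tau>b)
  qed

  have Pj: "P j \<in> topspace (pts R) - {P0, Pinf}" "\<tau> (P j) = P j" for j
  proof -
    have "P j \<in> ovals R \<tau>" using P(3) by blast
    then show "P j \<in> topspace (pts R) - {P0, Pinf}" "\<tau> (P j) = P j"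
      using regions(1,2) by (auto simp: ovals_def)
  qed
  define A where "A j = reg_path_integral R \<nu> \<Omega>inf (pth (P j))" for j
  define B where "B j = path_integral R \<Omega>0 (pth (P j))" for j
  have pathj: "pathin (pts R) (pth (P j))" "pth (P j) 0 = Pinf" "pth (P j) 1 = P j"
    "\<And>t. t \<in> {0<..1} \<Longrightarrow> pth (P j) t \<noteq> Pinf" for j
    using pth Pj(1)[of j] by auto
  have pathj0: "pth (P j) t \<noteq> P0" if "t \<in> {0..1}" for j t
  proof (cases "t = 0")
    case False
    then show ?thesis using pth Pj(1)[of j] that by auto
  qed (use pathj(2) points(3) in auto)
  \<comment> \<open>\<open>A j\<close> and \<open>B j\<close> are the two integrals in the exponent of the Baker--Akhiezer function at \<open>P j\<close>.
    The constant \<open>K\<close> is the regularized integral of \<open>\<Omega>inf\<close> from \<open>Pinf\<close> to \<open>\<tau> Pinf\<close> through a real point;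
    it is the same for all \<open>j\<close> because the paths differ by anti-invariant cycles.\<close>
  define K where "K = increment (pth (P 0)) - increment (\<tau> \<circ> pth (P 0)) + pole_part (\<tau> Pinf)"
  have AB: "B j = cnj (A j) - cnj K" for j
  proof -
    have "A j = increment (pth (P j)) + pole_part (P j)"
      using reg_path_integral_eq_increment[OF pathj(1,2,4)] pathj(3) by (simp add: A_def)
    moreover have "B j = cnj (increment (\<tau> \<circ> pth (P j)) + pole_part (P j) - pole_part (\<tau> Pinf))"
      using conj_integral[OF pathj(1) pathj0] pathj(2,3) Pj(2) by (simp add: B_def)
    moreover have "increment (pth (P j)) - increment (\<tau> \<circ> pth (P j)) =
        increment (pth (P 0)) - increment (\<tau> \<circ> pth (P 0))"
      by (rule antisymmetric_increment[OF \<tau>c \<tau>\<tau> span a_increment])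
        (use pathj Pj(2) in auto)
    ultimately show ?thesis unfolding K_def
      by (simp add: algebra_simps flip: complex_cnj_diff complex_cnj_add)
  qed

  \<comment> \<open>Otherwise \<open>\<psi> z\<close> would vanish near \<open>Pinf\<close>, against its normalization.\<close>
  have f0: "f z \<noteq> 0" for z
  proof
    assume "f z = 0"
    then have "\<psi> z p / (inverse (\<nu> p ^ 3) * exp (\<i> * \<nu> p * z)) = 0"
      if "p \<in> topspace (pts R) - {P0}" "p \<noteq> Pinf" for p
      using \<psi> that by simp
    moreover have "openin (pts R) (topspace (pts R) - {P0})"
      by (rule openin_delete_point[OF R openin_topspace])
    ultimately have "\<forall>\<^sub>F p in atin (pts R) Pinf. \<psi> z p / (inverse (\<nu> p ^ 3) * exp (\<i> * \<nu> p * z)) = 0"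
      unfolding eventually_atin using points by (intro disjI2 exI[of _ "topspace (pts R) - {P0}"]) auto
    then have "((\<lambda>p. \<psi> z p / (inverse (\<nu> p ^ 3) * exp (\<i> * \<nu> p * z))) \<longlongrightarrow> 0) (atin (pts R) Pinf)"
      by (rule tendsto_eventually)
    from tendsto_unique[OF point_not_isolated[OF R points(2)] this f[rule_format]] show False by simp
  qed

  show ?thesis
  proof (intro ballI allI)
    fix Z z assume Z12: "Z \<in> {Z1, Z2}"
    \<comment> \<open>The factor acquired by all three components under the shift by \<open>Z\<close>.\<close>
    define c where "c = f (z + Z) / f z * exp (- \<i> * cnj Z * cnj K)"
    have real_part: "\<i> * w + \<i> * cnj w = 2 * complex_of_real (Re w) * \<i>" for w
      by (simp add: complex_eq_iff)
    have \<eta>_shift: "\<eta> (\<lambda>i. w i + \<i> * U i * (z + Z) + \<i> * V i * cnj (z + Z) - e i) =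
        \<eta> (\<lambda>i. w i + \<i> * U i * z + \<i> * V i * cnj z - e i)" for w
      unfolding \<eta>
    proof (rule prym_theta_periodic)
      fix i assume i: "i \<in> {1..g}"
      obtain n :: int where n: "Re (Z * U i) = pi * of_int n" using ZU Z12 i by blast
      have "\<i> * U i * Z + \<i> * V i * cnj Z = \<i> * (Z * U i) + \<i> * cnj (Z * U i)"
        using VU[OF i] by (simp add: mult_ac)
      also have "\<dots> = 2 * complex_of_real pi * \<i> * of_int n"
        unfolding real_part n by simp
      finally show "\<exists>n::int. w i + \<i> * U i * (z + Z) + \<i> * V i * cnj (z + Z) - e i =
          w i + \<i> * U i * z + \<i> * V i * cnj z - e i + 2 * complex_of_real pi * \<i> * of_int n"
        by (intro exI[of _ n]) (simp add: algebra_simps)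
    qed
    have exp_shift: "exp (\<i> * (z + Z) * A j + \<i> * cnj (z + Z) * B j) =
        exp (\<i> * z * A j + \<i> * cnj z * B j) * exp (- \<i> * cnj Z * cnj K)" for j
    proof -
      obtain n :: int where n: "Re (Z * A j) = pi * of_int n" using ZP Z12 unfolding A_def by blast
      have "\<i> * (z + Z) * A j + \<i> * cnj (z + Z) * B j =
          (\<i> * z * A j + \<i> * cnj z * B j) + (- \<i> * cnj Z * cnj K) + (\<i> * (Z * A j) + \<i> * cnj (Z * A j))"
        by (simp add: AB algebra_simps)
      also have "\<dots> = (\<i> * z * A j + \<i> * cnj z * B j) + (- \<i> * cnj Z * cnj K) + 2 * of_int n * complex_of_real pi * \<i>"
        unfolding real_part n by simp
      finally have sum: "\<i> * (z + Z) * A j + \<i> * cnj (z + Z) * B j = \<dots>" .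
      have "exp (2 * of_int n * complex_of_real pi * \<i>) = 1"
        by (auto simp: exp_eq_1 intro!: exI[of _ n])
      then show ?thesis unfolding sum exp_add by simp
    qed
    have "\<psi> (z + Z) (P j) = c * \<psi> z (P j)" for j
    proof -
      have *: "\<psi> z' (P j) = f z' *
          (\<eta> (\<lambda>i. prym_map R g \<omega> (pth (P j)) i + \<i> * U i * z' + \<i> * V i * cnj z' - e i) /
           \<eta> (\<lambda>i. prym_map R g \<omega> (pth (P j)) i - e i)) * inverse (lam (P j)) *
          exp (\<i> * z' * A j + \<i> * cnj z' * B j)" for z'
        using \<psi> Pj(1) by (simp add: A_def B_def)
      show ?thesis unfolding * \<eta>_shift exp_shift c_def using f0[of z] by simp
    qed
    then have "(\<chi> j. \<psi> (z + Z) (P j) / csqrt (W (P j))) = c *s (\<chi> j. \<psi> z (P j) / csqrt (W (P j)))"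
      by (simp add: vec_eq_iff)
    moreover have "c \<noteq> 0" using f0 by (simp add: c_def)
    ultimately show "x (z + Z) = x z" unfolding x by (simp add: proj_point_scale)
  qed
qed

end
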